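(* For the round-robin induced periodic system (RRIPS) $$\bar x_{k+1}=\bar A\,\bar x_k+\bar B(z)w_k,\qquad y_k^{m_k}=\bar H_{m_k}\bar x_k+v_k^{m_k},$$ described in the context, and under the standing assumptions on the risk-sensitive filter listed there, the posterior estimate and the posterior error covariance are obtained as $$\hat{\bar x}_{k|k}=\hat{\bar x}_{k|k-1}+\bar P_{\bar xy}^{m_k}(\bar P_{yy}^{m_k})^{-1}\left(y_k^{m_k}-\bar H_{m_k}\hat{\bar x}_{k|k-1}\right),$$ $$\bar P_{k|k}=\bar P_{k|k-1}-\bar P_{\bar xy}^{m_k}(\bar P_{yy}^{m_k})^{-1}(\bar P_{\bar xy}^{m_k})^\top ,$$ where $\hat{\bar x}_{k|k-1}$ and $\bar P_{k|k-1}$ are the predicted mean and predicted error covariance, $\bar P_{yy}^{m_k}=\bar H_{m_k}\bar P_{k|k-1}\bar H_{m_k}^\top+R_k^{m_k}$ is the innovation covariance with $R_k^{m_k}=\mathbb E[v_k^{m_k}(v_k^{m_k})^\top]$, and $\bar P_{\bar xy}^{m_k}=\bar P_{k|k-1}\bar H_{m_k}^\top$ is the cross covariance of the state and the measurement.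
   Context: System. The nominal discrete-time stochastic singular system is $Ex_{k+1}=Ax_k+Bw_k$, $y_k=Hx_k+v_k$, with $E,A\in\mathbb{R}^{n\times n}$, $\operatorname{rank}E<n$, $B\in\mathbb{R}^{n\times r}$, $H\in\mathbb{R}^{q\times n}$, and $(E,A)$ regular, i.e. $\det(\lambda E-A)\not\equiv0$. The noises $w_k,v_k$ are zero-mean Gaussian with $\mathbb E[w_kw_k^\top]=Q_k$, $\mathbb E[v_kv_k^\top]=R_k$, and $\mathbb E[w_kv_j^\top]=0$ for all $k,j$. The initial state $x_0$ is zero-mean with known covariance, independent of $v_k$, but possibly correlated with $w_0$ and finitely many future process noise terms. By regularity there are nonsingular $U,V$ (Weierstrass canonical form) with $UEV=\operatorname{diag}(I_{n_1},N)$, $UAV=\operatorname{diag}(A_1,I_{n_2})$, $n_1+n_2=n$, $N$ nilpotent with $N^h=0$. Write $UB=[B_1^\top\ B_2^\top]^\top$, $HV=[H_1\ H_2]$, $x_k=V\bar x_k$. Set $\bar A=\operatorname{diag}(A_1,0)$, $\bar H=[H_1\ H_2]$, $\bar B(z)=B^{(0)}+B^{(1)}z+\dots+B^{(h)}z^h$, where $z$ is the forward shift ($zw_k=w_{k+1}$), $B^{(0)}=\begin{bmatrix}B_1\\0\end{bmatrix}$, $B^{(i)}=-\begin{bmatrix}0\\N^{i-1}B_2\end{bmatrix}$ for $i=1,\dots,h$. The process noise covariance of the transformed model is $\bar Q_k=\mathbb E[(\bar B(z)w_k)(\bar B(z)w_k)^\top]=\sum_{i=0}^hB^{(i)}Q_{k+i}(B^{(i)})^\top$.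 Round-robin protocol. Only $q'$ of the $q$ measurement components are transmitted at each time. With $\sigma=\lceil q/q'\rceil$ and $m_k=(k\bmod\sigma)+1$, $y_k^{m_k}$ consists of components $(m_k-1)q'+1,\dots,m_kq'$ of $y_k$ (if $m_k=\sigma$: components $(\sigma-1)q'+1,\dots,q$, with additional entries from the first $(\sigma-1)q'$ components appended if needed so that the length is $q'$); $v_k^{m_k}$ and $\bar H_{m_k}$ consist of the corresponding entries of $v_k$ and rows of $\bar H$. The received measurements up to time $k$ are denoted $y_{1:k}^{m_k}$. Risk-sensitive estimation. Let $\mu_{1,i}\ge0$ and $\mu_{2,k}>0$ be risk parameters, and $e_{i|i}=\bar x_i-\hat{\bar x}_{i|i}$ the posterior estimation error. The posterior estimate $\hat{\bar x}_{k|k}$ is the minimizer of the cost $\mathbb E\big[\exp\big(\sum_{i=1}^{k-1}\mu_{1,i}e_{i|i}^\top e_{i|i}+\mu_{2,k}e_{k|k}^\top e_{k|k}\big)\big]$ given $y_{1:k}^{m_k}$ (the earlier optimal estimates being already available); in terms of the information state $\Phi_k$ below, this cost is $\int\exp(\mu_{2,k}e_{k|k}^\top e_{k|k})\,\Phi_k\,d\bar x_k$. The information state is $\Phi_k=p(\bar x_k\mid\mathcal I_k)=\exp\big(\sum_{i=0}^{k-1}\mu_{1,i}e_{i|i}^\top e_{i|i}\big)\,p(\bar x_k\mid y_{1:k}^{m_k})$ with $\Phi_0=p(\bar x_0)$ and $\mathcal I_k=\{y_{1:k}^{m_k},e_{1|1},\dots,e_{k-1|k-1}\}$. The predicted information state,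 with $\bar{\mathcal I}_{k-1}=\{\mathcal I_{k-1},e_{k-1|k-1}\}$, is $$p(\bar x_k\mid\bar{\mathcal I}_{k-1})=\int p(\bar x_k\mid\bar x_{k-1})\exp\!\left(\mu_{1,k-1}e_{k-1|k-1}^\top e_{k-1|k-1}\right)\Phi_{k-1}\,d\bar x_{k-1},$$ and the information state is propagated by $\Phi_k=p(y_k^{m_k}\mid\bar x_k)\,p(\bar x_k\mid\bar{\mathcal I}_{k-1})/p(y_k^{m_k}\mid y_{1:k-1}^{m_k})$. Standing assumptions on the filter: $\Phi_k$ is assumed to be an unnormalized Gaussian density for sufficiently small nonnegative $\mu_{1,k-1}$ ($\Phi_0=p(\bar x_0)$ being Gaussian), and $\mu_{1,k-1}$ is selected such that $2\mu_{1,k-1}\bar P_{k-1|k-1}<I$ (in the positive definite order). Predicted quantities: $\hat{\bar x}_{k|k-1}=\bar A\hat{\bar x}_{k-1|k-1}$ and $\bar P_{k|k-1}=\bar A(\bar P_{k-1|k-1}^{-1}-2\mu_{1,k-1}I)^{-1}\bar A^\top+\bar Q_k$. The posterior error covariance $\bar P_{k|k}$ is the covariance of the Gaussian $\Phi_k$. The innovation covariance is by definition $\bar P_{yy}^{m_k}=\mathbb E[\bar y_k^{m_k}(\bar y_k^{m_k})^\top]$ with $\bar y_k^{m_k}=y_k^{m_k}-\mathbb E[y_k^{m_k}\mid\bar{\mathcal I}_{k-1}]$ and $\mathbb E[y_k^{m_k}\mid\bar{\mathcal I}_{k-1}]=\bar H_{m_k}\hat{\bar x}_{k|k-1}$, and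 the cross covariance is $\bar P_{\bar xy}^{m_k}=\mathbb E[(\bar x_k-\hat{\bar x}_{k|k-1})(\bar y_k^{m_k})^\top]$.
   Formalization: The noise index in the predicted covariance must match the transition from k−1 to k: either Q̄_{k−1} replaces Q̄_k, or the transition noise is given index k. Also p(x̄_k|x̄_{k−1}) is taken as the law of Āx̄_{k−1}+B̄(z)w with x̄_{k−1} held fixed. *)

theory Defs
  imports "HOL-Probability.Probability"
begin

section \<open>Matrices\<close>

definition pos_def :: "real^'n^'n \<Rightarrow> bool" where
  "pos_def S \<longleftrightarrow> transpose S = S \<and> (\<forall>x. x \<noteq> 0 \<longrightarrow> 0 < x \<bullet> (S *v x))"

definition mat_pow :: "real^'n^'n \<Rightarrow> nat \<Rightarrow> real^'n^'n" where
  "mat_pow X i = (((**) X) ^^ i) (mat 1)"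

(* A splitting n = n1 + n2 of the coordinates is given by the set S of the first n1 of them,
   so that n1 = card S may also be 0. Blocks are padded with zeros to full size. *)

definition block_diag :: "'n set \<Rightarrow> real^'n^'n \<Rightarrow> real^'n^'n \<Rightarrow> real^'n^'n" where
  "block_diag S X Y =
     (\<chi> i j. if i \<in> S \<and> j \<in> S then X $ i $ j
             else if i \<notin> S \<and> j \<notin> S then Y $ i $ j else 0)"

definition row_block :: "'n set \<Rightarrow> real^'m^'n \<Rightarrow> real^'m^'n" where
  "row_block S X = (\<chi> i. if i \<in> S then X $ i else 0)"

(* The coefficients of the polynomial in the forward shift that multiplies the process noise;
   UB is the transformed input matrix and N the (padded) nilpotent block. *)

definition shift_coeff :: "'n set \<Rightarrow> real^'n^'n \<Rightarrow> real^'r^'n \<Rightarrow> nat \<Rightarrow> real^'r^'n" where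
  "shift_coeff S N UB i =
     (if i = 0 then row_block S UB else - (mat_pow N (i - 1) ** row_block (- S) UB))"

section \<open>Random vectors and Gaussian densities\<close>

(* E[X Y^T] *)
definition second_moment ::
  "'a measure \<Rightarrow> ('a \<Rightarrow> real^'n) \<Rightarrow> ('a \<Rightarrow> real^'m) \<Rightarrow> real^'m^'n" where
  "second_moment M X Y = (\<chi> i j. \<integral>\<omega>. X \<omega> $ i * Y \<omega> $ j \<partial>M)"

definition covariance :: "'a measure \<Rightarrow> ('a \<Rightarrow> real^'n) \<Rightarrow> real^'n^'n" where
  "covariance M X =
     second_moment M (\<lambda>\<omega>. X \<omega> - (\<integral>\<omega>'. X \<omega>' \<partial>M)) (\<lambda>\<omega>. X \<omega> - (\<integral>\<omega>'. X \<omega>' \<partial>M))"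

(* The covariance of a Gaussian vector may be singular: a linear functional of it
   may be almost surely constant. *)
definition gaussian_vector :: "'a measure \<Rightarrow> ('a \<Rightarrow> real^'n) \<Rightarrow> bool" where
  "gaussian_vector M X \<longleftrightarrow>
     X \<in> borel_measurable M \<and>
     (\<forall>u. (\<exists>m. distr M borel (\<lambda>\<omega>. u \<bullet> X \<omega>) = return borel m) \<or>
          (\<exists>m s. 0 < s \<and> distributed M lborel (\<lambda>\<omega>. u \<bullet> X \<omega>) (normal_density m s)))"

(* prob_space.indep_var relates random variables with values in the same type only. *)
definition indep_vectors :: "'a measure \<Rightarrow> ('a \<Rightarrow> real^'n) \<Rightarrow> ('a \<Rightarrow> real^'m) \<Rightarrow> bool" where
  "indep_vectors M X Y \<longleftrightarrow>
     prob_space.indep_set M {X -` T \<inter> space M | T. T \<in> sets borel}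
       {Y -` T \<inter> space M | T. T \<in> sets borel}"

(* Density with mean m and covariance S at x. Meaningful for positive definite S only;
   the expression is identically 0 if det S = 0. *)
definition mvn_density :: "real^'n \<Rightarrow> real^'n^'n \<Rightarrow> real^'n \<Rightarrow> real" where
  "mvn_density m S x =
     exp (- (1/2) * ((x - m) \<bullet> (matrix_inv S *v (x - m)))) / sqrt ((2 * pi) ^ CARD('n) * det S)"

definition unnormalized_gaussian :: "(real^'n \<Rightarrow> real) \<Rightarrow> bool" where
  "unnormalized_gaussian f \<longleftrightarrow>
     (\<exists>c m S. 0 < c \<and> pos_def S \<and> f = (\<lambda>x. c * mvn_density m S x))"

definition normalized :: "(real^'n \<Rightarrow> real) \<Rightarrow> (real^'n) measure" where
  "normalized f = density lborel (\<lambda>x. ennreal (f x / (\<integral>z. f z \<partial>lborel)))"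

section \<open>Round-robin protocol\<close>

definition rr_period :: "nat \<Rightarrow> nat \<Rightarrow> nat" where
  "rr_period q q' = nat \<lceil>real q / real q'\<rceil>"

definition rr_phase :: "nat \<Rightarrow> nat \<Rightarrow> nat \<Rightarrow> nat" where
  "rr_phase q q' k = k mod rr_period q q' + 1"

(* The component (counted from 1) of the full measurement that is sent in position j at time k.
   Beyond component q, which happens only in the last phase, pad j names the appended one. *)
definition rr_slot :: "nat \<Rightarrow> nat \<Rightarrow> (nat \<Rightarrow> nat) \<Rightarrow> nat \<Rightarrow> nat \<Rightarrow> nat" where
  "rr_slot q q' pad k j =
     (let i = (rr_phase q q' k - 1) * q' + j in if i \<le> q then i else pad j)"

(* cq and cp number the two index types by 1, ..., q and 1, ..., q'. With 'b = real this selects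
   entries of a vector, with 'b = real^'n it selects rows of a matrix. *)
definition rr_select ::
  "(nat \<Rightarrow> 'q) \<Rightarrow> ('p \<Rightarrow> nat) \<Rightarrow> (nat \<Rightarrow> nat) \<Rightarrow> nat \<Rightarrow> 'b^'q \<Rightarrow> 'b^'p" where
  "rr_select cq cp pad k z = (\<chi> j. z $ cq (rr_slot CARD('q) CARD('p) pad k (cp j)))"

section \<open>Risk-sensitive estimation\<close>

(* Extended-valued, so that a divergent cost is infinite and not 0. *)
definition risk_cost :: "real \<Rightarrow> (real^'n \<Rightarrow> real) \<Rightarrow> real^'n \<Rightarrow> ennreal" where
  "risk_cost \<mu> \<Phi> a = (\<integral>\<^sup>+x. ennreal (exp (\<mu> * ((x - a) \<bullet> (x - a))) * \<Phi> x) \<partial>lborel)"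

definition is_minimizer :: "('b \<Rightarrow> ennreal) \<Rightarrow> 'b \<Rightarrow> bool" where
  "is_minimizer J a \<longleftrightarrow> J a < \<infinity> \<and> (\<forall>b. J a \<le> J b)"

(* g is a density of the measure  integral K(x', dx) f(x') dx'. If every K(x') has a density
   p(x | x'), this says g(x) = integral p(x | x') f(x') dx' for almost every x; no density
   is required of K, so that singular process noise covariances are included. *)
definition predicts :: "(real^'n \<Rightarrow> (real^'n) measure) \<Rightarrow> (real^'n \<Rightarrow> real) \<Rightarrow> (real^'n \<Rightarrow> real) \<Rightarrow> bool" where
  "predicts K f g \<longleftrightarrow>
     g \<in> borel_measurable borel \<and> (\<forall>x. 0 \<le> g x) \<and>
     (\<forall>T \<in> sets borel.
        (\<integral>\<^sup>+x\<in>T. ennreal (g x) \<partial>lborel) = (\<integral>\<^sup>+x'. emeasure (K x') T * ennreal (f x') \<partial>lborel))"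

(* p(y_k | y_1, ..., y_{k-1}) from joint densities fy k of (y_1, ..., y_k) *)
definition cond_density :: "(nat \<Rightarrow> (nat \<Rightarrow> 'b) \<Rightarrow> real) \<Rightarrow> (nat \<Rightarrow> 'b) \<Rightarrow> nat \<Rightarrow> real" where
  "cond_density fy y k = fy k (restrict y {1..k}) / fy (k - 1) (restrict y {1..k - 1})"

end

theory Submission
  imports Defs
begin

text \<open>The cost is minimized at the centre of the Gaussian information state, since it is symmetric about that
  point and strictly convex. Multiplying the previous information state by the exponential of the last error
  gives a Gaussian with precision reduced by 2 mu, and the prediction step turns its mean and covariance into the
  predicted ones; this uses only the first two moments of the process noise, which need not be jointly Gaussian.
  Dividing the new information state by the Gaussian likelihood shows that the predicted information state is the
  exponential of a quadratic polynomial. As it is integrable with finite first moments, it is an unnormalized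
  Gaussian, hence determined by those two moments. So the posterior precision is the sum of the predicted
  precision and H^T R^-1 H, and the claim is the matrix inversion lemma.\<close>

section \<open>Positive definite matrices\<close>

text \<open>The matrices \<open>Abar\<close> and \<open>Qbar\<close> may be singular, so in general
  the transition kernel has no density and the predicted covariance cannot be inverted in advance.
  The prediction is therefore handled at the level of laws: the normalized predicted information
  state is the image of a product measure, which yields a mean and a covariance but says nothing
  about the shape. Invertibility is an output of the argument: of \<open>Rm k\<close> because the
  likelihood does not vanish, of \<open>Ppred k\<close> because it turns out to be the inverse of a
  precision matrix. As every information state is assumed Gaussian, a single step for fixed
  \<open>k\<close> suffices and there is no induction on time.\<close>

lemma pos_def_symmetric: "pos_def S \<Longrightarrow> transpose S = S"
  by (simp add: pos_def_def)

lemma inner_matrix_vector: "x \<bullet> ((S::real^'n^'m) *v y) = (transpose S *v x) \<bullet> y"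
  by (simp add: dot_lmul_matrix)

lemma symmetric_inner_commute:
  "transpose S = S \<Longrightarrow> x \<bullet> ((S::real^'n^'n) *v y) = y \<bullet> (S *v x)"
  by (metis inner_commute inner_matrix_vector)

lemma invertible_if_kernel_trivial:
  fixes S :: "real^'n^'n"
  assumes "\<And>x. S *v x = 0 \<Longrightarrow> x = 0"
  shows "invertible S"
  using assms by (auto simp: invertible_left_inverse matrix_left_invertible_ker)

lemma invertible_if_pos_inner:
  fixes S :: "real^'n^'n"
  assumes "\<And>x. x \<noteq> 0 \<Longrightarrow> 0 < x \<bullet> (S *v x)"
  shows "invertible S"
  by (rule invertible_if_kernel_trivial) (use assms in force)

lemma pos_def_invertible: "pos_def S \<Longrightarrow> invertible S"
  by (rule invertible_if_pos_inner) (simp add: pos_def_def)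

lemma matrix_inv_mult:
  fixes S :: "real^'n^'n"
  assumes "invertible S"
  shows "S ** matrix_inv S = mat 1" "matrix_inv S ** S = mat 1"
proof -
  have "\<exists>B. S ** B = mat 1 \<and> B ** S = mat 1"
    using assms by (simp add: invertible_def)
  from someI_ex[OF this] show "S ** matrix_inv S = mat 1" "matrix_inv S ** S = mat 1"
    by (auto simp: matrix_inv_def)
qed

lemma matrix_inv_vec:
  fixes S :: "real^'n^'n"
  assumes "invertible S"
  shows "S *v (matrix_inv S *v x) = x" "matrix_inv S *v (S *v x) = x"
  using assms by (simp_all add: matrix_vector_mul_assoc matrix_inv_mult)

lemma matrix_inv_eqI:
  fixes S :: "real^'n^'n"
  assumes "S ** T = mat 1"
  shows "matrix_inv S = T"
proof -
  have "invertible S" using assms by (auto simp: invertible_right_inverse)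
  then have "matrix_inv S = matrix_inv S ** (S ** T)" using assms by simp
  also have "\<dots> = T" using \<open>invertible S\<close> by (simp add: matrix_mul_assoc matrix_inv_mult)
  finally show ?thesis .
qed

lemma matrix_inv_inv: "invertible (S::real^'n^'n) \<Longrightarrow> matrix_inv (matrix_inv S) = S"
  by (intro matrix_inv_eqI) (simp add: matrix_inv_mult)

lemma pos_def_matrix_inv:
  fixes S :: "real^'n^'n"
  assumes "pos_def S"
  shows "pos_def (matrix_inv S)"
proof -
  have inv: "invertible S" using assms by (rule pos_def_invertible)
  have "S ** transpose (matrix_inv S) = transpose (matrix_inv S ** S)"
    by (simp add: matrix_transpose_mul pos_def_symmetric[OF assms])
  then have "transpose (matrix_inv S) = matrix_inv S"
    by (intro matrix_inv_eqI[symmetric]) (simp add: matrix_inv_mult[OF inv])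
  moreover have "0 < x \<bullet> (matrix_inv S *v x)" if "x \<noteq> 0" for x
  proof -
    let ?y = "matrix_inv S *v x"
    have "?y \<noteq> 0" using that matrix_inv_vec(1)[OF inv, of x] by auto
    then have "0 < ?y \<bullet> (S *v ?y)" using assms by (simp add: pos_def_def)
    then show ?thesis by (simp add: matrix_inv_vec[OF inv] inner_commute)
  qed
  ultimately show ?thesis by (simp add: pos_def_def)
qed

text \<open>Along the segment from the identity to \<open>S\<close> every matrix has a positive
  quadratic form and is therefore invertible, so the determinant cannot reach 0 on its way from 1.
  This makes the normalizing factor of \<open>mvn_density\<close> positive.\<close>

lemma pos_def_det_pos:
  fixes S :: "real^'n^'n"
  assumes "pos_def S"
  shows "0 < det S"
proof (rule ccontr)
  assume neg: "\<not> 0 < det S"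
  define F where "F t = det ((1 - t) *\<^sub>R mat 1 + t *\<^sub>R S)" for t :: real
  have "continuous_on {0..1} F"
    unfolding F_def det_def by (auto intro!: continuous_intros)
  moreover have "F 1 \<le> 0" "0 \<le> F 0" using neg by (auto simp: F_def)
  ultimately obtain t where t: "0 \<le> t" "t \<le> 1" "F t = 0"
    using IVT2'[of F 1 0 0] by auto
  have "0 < x \<bullet> (((1 - t) *\<^sub>R mat 1 + t *\<^sub>R S) *v x)" if "x \<noteq> 0" for x :: "real^'n"
  proof -
    have "0 < x \<bullet> (S *v x)" "0 < x \<bullet> x" using that assms by (auto simp: pos_def_def)
    then have "0 < (1 - t) * (x \<bullet> x) + t * (x \<bullet> (S *v x))"
      using t by (cases "t = 0") (auto intro: add_nonneg_pos)
    then show ?thesis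
      by (simp add: matrix_vector_mult_add_rdistrib scaleR_matrix_vector_assoc[symmetric] inner_add_right)
  qed
  from invertible_if_pos_inner[OF this] t show False
    by (simp add: F_def invertible_det_nz)
qed

text \<open>Compactness of the unit sphere gives a positive minimum of the form, and homogeneity of
  degree 2 carries it to all vectors. Integrability of Gaussian weights rests on this
  constant.\<close>

lemma pos_def_coercive:
  fixes S :: "real^'n^'n"
  assumes "pos_def S"
  obtains c where "0 < c" "\<And>x. c * (norm x)\<^sup>2 \<le> x \<bullet> (S *v x)"
proof -
  let ?q = "\<lambda>x. x \<bullet> (S *v x)"
  have "continuous_on (sphere 0 1) ?q" by (intro continuous_intros)
  moreover have "sphere (0::real^'n) 1 \<noteq> {}" by simp
  ultimately obtain a where a: "norm a = 1" "\<And>x. norm x = 1 \<Longrightarrow> ?q a \<le> ?q x"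
    using continuous_attains_inf[of "sphere 0 1" ?q] by auto
  have "?q a * (norm x)\<^sup>2 \<le> ?q x" for x
  proof (cases "x = 0")
    case False
    have "?q a \<le> ?q (x /\<^sub>R norm x)" using False by (intro a) simp
    also have "\<dots> = ?q x / (norm x)\<^sup>2"
      by (simp add: matrix_vector_mult_scaleR power2_eq_square divide_inverse)
    finally show ?thesis using False by (simp add: field_simps)
  qed simp
  moreover have "a \<noteq> 0" using a(1) by auto
  then have "0 < ?q a" using assms by (simp add: pos_def_def)
  ultimately show thesis by (rule that[rotated])
qed

text \<open>A positive semidefinite form that vanishes at x attains its minimum there, so its
  gradient vanishes as well.\<close>
lemma pos_semidef_invertible_imp_pos_def:
  fixes S :: "real^'n^'n"
  assumes sym: "transpose S = S" and psd: "\<And>x. 0 \<le> x \<bullet> (S *v x)" and inv: "invertible S"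
  shows "pos_def S"
proof -
  have "0 < x \<bullet> (S *v x)" if "x \<noteq> 0" for x
  proof (rule ccontr)
    assume "\<not> 0 < x \<bullet> (S *v x)"
    then have zero: "x \<bullet> (S *v x) = 0" using psd[of x] by simp
    let ?z = "S *v x"
    have "?z \<noteq> 0" using that matrix_inv_vec(2)[OF inv, of x] by auto
    then have pos: "0 < ?z \<bullet> ?z" by simp
    define b where "b = ?z \<bullet> (S *v ?z)"
    have b: "0 \<le> b" unfolding b_def by (rule psd)
    \<comment> \<open>Step length for moving from \<open>x\<close> against the gradient. The
      \<open>+ 1\<close> keeps the denominator positive when \<open>b\<close> is 0, and
      \<open>t * b\<close> still stays below the squared norm of \<open>?z\<close>.\<close>
    define t where "t = (?z \<bullet> ?z) / (b + 1)"
    have t: "0 < t" "t * b < ?z \<bullet> ?z" using pos b by (auto simp: t_def field_simps)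
    have "0 \<le> (x - t *\<^sub>R ?z) \<bullet> (S *v (x - t *\<^sub>R ?z))" by (rule psd)
    also have "\<dots> = t * (t * b - 2 * (?z \<bullet> ?z))"
      using zero symmetric_inner_commute[OF sym, of x ?z]
      by (simp add: matrix_vector_mult_diff_distrib matrix_vector_mult_scaleR inner_diff_left
          inner_diff_right b_def[symmetric] algebra_simps)
    also have "\<dots> < 0" using t(1) by (rule mult_pos_neg) (use t(2) pos in linarith)
    finally show False by simp
  qed
  then show ?thesis using sym by (simp add: pos_def_def)
qed

section \<open>Matrix inversion lemma for the filter update\<close>

lemma transpose_add: "transpose (A + B) = transpose A + transpose (B::real^'n^'m)"
  by (simp add: transpose_def vec_eq_iff)

lemma transpose_diff: "transpose (A - B) = transpose A - transpose (B::real^'n^'m)"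
  by (simp add: transpose_def vec_eq_iff)

lemma matrix_diff_ldistrib: "(A::real^'n^'m) ** (B - C) = A ** B - A ** (C::real^'k^'n)"
  by (simp add: matrix_matrix_mult_def vec_eq_iff right_diff_distrib sum_subtractf)

lemma matrix_diff_rdistrib: "(B - C) ** (A::real^'k^'n) = B ** A - C ** (A::real^'k^'n)"
  for B C :: "real^'n^'m"
  by (simp add: matrix_matrix_mult_def vec_eq_iff left_diff_distrib sum_subtractf)

lemma matrix_add_rdistrib: "(B + C) ** (A::real^'k^'n) = B ** A + C ** (A::real^'k^'n)"
  for B C :: "real^'n^'m"
  by (simp add: matrix_matrix_mult_def vec_eq_iff distrib_right sum.distrib)

lemma pos_def_congruence_add:
  fixes P :: "real^'n^'n" and R :: "real^'p^'p" and H :: "real^'n^'p"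
  assumes P: "pos_def P" and R: "pos_def R"
  shows "pos_def (H ** P ** transpose H + R)"
proof -
  have "transpose (H ** P ** transpose H + R) = H ** P ** transpose H + R"
    using P R by (simp add: transpose_add matrix_transpose_mul pos_def_symmetric matrix_mul_assoc)
  moreover have "0 < x \<bullet> ((H ** P ** transpose H + R) *v x)" if "x \<noteq> 0" for x
  proof -
    let ?y = "transpose H *v x"
    have "x \<bullet> ((H ** P ** transpose H + R) *v x) = ?y \<bullet> (P *v ?y) + x \<bullet> (R *v x)"
      by (simp add: matrix_vector_mult_add_rdistrib inner_add_right inner_matrix_vector
          matrix_vector_mul_assoc[symmetric] del: transpose_matrix_vector)
    moreover have "0 \<le> ?y \<bullet> (P *v ?y)" using P by (cases "?y = 0") (auto simp: pos_def_def less_imp_le)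
    moreover have "0 < x \<bullet> (R *v x)" using R that by (simp add: pos_def_def)
    ultimately show ?thesis by simp
  qed
  ultimately show ?thesis by (simp add: pos_def_def)
qed

text \<open>The candidate is verified by multiplying it with the posterior precision. Replacing
  \<open>H ** P ** transpose H\<close> by \<open>W - R\<close> splits the mixed term into one part
  without \<open>matrix_inv W\<close> and one without \<open>matrix_inv R\<close>, and each cancels
  against a remaining term.\<close>

lemma kalman_covariance:
  fixes J :: "real^'n^'n" and R :: "real^'p^'p" and H :: "real^'n^'p"
  assumes J: "pos_def J" and R: "pos_def R"
    and S: "pos_def S" "matrix_inv S = J + transpose H ** matrix_inv R ** H"
    and P: "P = matrix_inv J" and W: "W = H ** P ** transpose H + R"
  shows "S = P - P ** transpose H ** matrix_inv W ** (H ** P)"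
proof -
  let ?L = "matrix_inv W" and ?G = "matrix_inv R"
  have W_inv: "invertible W"
    unfolding W P by (intro pos_def_invertible pos_def_congruence_add pos_def_matrix_inv J R)
  have JP: "J ** P = mat 1" unfolding P by (intro matrix_inv_mult pos_def_invertible J)
  have GR: "?G ** R = mat 1" by (intro matrix_inv_mult pos_def_invertible R)
  have WL: "W ** ?L = mat 1" by (intro matrix_inv_mult W_inv)
  have HPH: "H ** P ** transpose H = W - R" by (simp add: W)
  have "J ** (P ** transpose H ** ?L ** (H ** P)) = transpose H ** ?L ** (H ** P)"
    by (simp add: matrix_mul_assoc JP)
  moreover have "transpose H ** ?G ** H ** (P ** transpose H ** ?L ** (H ** P))
      = transpose H ** ?G ** (H ** P ** transpose H) ** ?L ** (H ** P)"
    by (simp add: matrix_mul_assoc)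
  moreover have "\<dots> = transpose H ** ?G ** (W ** ?L) ** (H ** P)
      - transpose H ** (?G ** R) ** ?L ** (H ** P)"
    unfolding HPH by (simp add: matrix_diff_ldistrib matrix_diff_rdistrib matrix_mul_assoc)
  ultimately have "matrix_inv S ** (P - P ** transpose H ** ?L ** (H ** P)) = mat 1"
    unfolding S(2) by (simp add: matrix_diff_ldistrib matrix_add_rdistrib JP WL GR matrix_mul_assoc)
  from matrix_inv_eqI[OF this] show ?thesis
    by (simp add: matrix_inv_inv pos_def_invertible S(1))
qed

text \<open>The heart is the equality of two forms of the Kalman gain: the posterior precision maps
  \<open>P ** transpose H ** matrix_inv W\<close> to \<open>transpose H ** matrix_inv R\<close>.
  After multiplication with that precision the two terms in \<open>H *v a\<close> cancel.\<close>

lemma kalman_mean: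
  fixes J :: "real^'n^'n" and R :: "real^'p^'p" and H :: "real^'n^'p"
  assumes J: "pos_def J" and R: "pos_def R"
    and S: "pos_def S" "matrix_inv S = J + transpose H ** matrix_inv R ** H"
    and P: "P = matrix_inv J" and W: "W = H ** P ** transpose H + R"
    and m: "matrix_inv S *v m = J *v a + transpose H *v (matrix_inv R *v y)"
  shows "m = a + (P ** transpose H) *v (matrix_inv W *v (y - H *v a))"
proof -
  let ?L = "matrix_inv W" and ?G = "matrix_inv R"
  have W_inv: "invertible W"
    unfolding W P by (intro pos_def_invertible pos_def_congruence_add pos_def_matrix_inv J R)
  have JP: "J ** P = mat 1" unfolding P by (intro matrix_inv_mult pos_def_invertible J)
  have GR: "?G ** R = mat 1" by (intro matrix_inv_mult pos_def_invertible R)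
  have WL: "W ** ?L = mat 1" by (intro matrix_inv_mult W_inv)
  have HPH: "H ** P ** transpose H = W - R" by (simp add: W)
  have "J ** (P ** transpose H ** ?L) = transpose H ** ?L"
    by (simp add: matrix_mul_assoc JP)
  moreover have "transpose H ** ?G ** H ** (P ** transpose H ** ?L)
      = transpose H ** ?G ** (H ** P ** transpose H) ** ?L"
    by (simp add: matrix_mul_assoc)
  moreover have "\<dots> = transpose H ** ?G ** (W ** ?L) - transpose H ** (?G ** R) ** ?L"
    unfolding HPH by (simp add: matrix_diff_ldistrib matrix_diff_rdistrib matrix_mul_assoc)
  ultimately have gain: "matrix_inv S ** (P ** transpose H ** ?L) = transpose H ** ?G"
    unfolding S(2) by (simp add: matrix_add_rdistrib WL GR)
  have "matrix_inv S *v (a + (P ** transpose H) *v (?L *v (y - H *v a)))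
      = matrix_inv S *v a + (matrix_inv S ** (P ** transpose H ** ?L)) *v (y - H *v a)"
    by (simp add: matrix_vector_right_distrib matrix_vector_mul_assoc matrix_mul_assoc)
  also have "\<dots> = matrix_inv S *v a + (transpose H ** ?G) *v (y - H *v a)"
    by (simp only: gain)
  also have "\<dots> = J *v a + transpose H *v (?G *v y)"
    unfolding S(2)
    by (simp add: matrix_vector_mult_add_rdistrib matrix_vector_mult_diff_distrib
        matrix_vector_mul_assoc matrix_mul_assoc del: transpose_matrix_vector)
  finally have "matrix_inv S *v (a + (P ** transpose H) *v (?L *v (y - H *v a))) = matrix_inv S *v m"
    by (simp add: m)
  then show ?thesis by (metis S(1) matrix_inv_vec(1) pos_def_invertible)
qed

section \<open>Second moments of square integrable vectors\<close>

text \<open>The integrals in \<open>second_moment\<close> have the value 0 when they diverge, so its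
  bilinearity has to be secured by an integrability condition. Stating it for coordinates keeps the
  integrability proofs one-dimensional.\<close>

definition square_integrable :: "'a measure \<Rightarrow> ('a \<Rightarrow> real^'n) \<Rightarrow> bool" where
  "square_integrable M X \<longleftrightarrow>
     X \<in> borel_measurable M \<and> (\<forall>i. integrable M (\<lambda>\<omega>. (X \<omega> $ i)\<^sup>2))"

lemma borel_measurable_vec_nth_comp:
  "X \<in> borel_measurable M \<Longrightarrow> (\<lambda>\<omega>. (X \<omega> :: real^'n) $ i) \<in> borel_measurable M"
  by (erule measurable_compose) (intro borel_measurable_continuous_onI continuous_intros)

lemma borel_measurable_matrix_vector:
  fixes A :: "real^'n^'m"
  assumes "X \<in> borel_measurable M"
  shows "(\<lambda>\<omega>. A *v X \<omega>) \<in> borel_measurable M"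
  using assms by (rule measurable_compose) (intro borel_measurable_continuous_onI continuous_intros)

lemma square_integrable_measurable: "square_integrable M X \<Longrightarrow> X \<in> borel_measurable M"
  by (simp add: square_integrable_def)

lemma square_integrable_mult:
  assumes X: "square_integrable M X" and Y: "square_integrable M Y"
  shows "integrable M (\<lambda>\<omega>. X \<omega> $ i * Y \<omega> $ j)"
proof (rule Bochner_Integration.integrable_bound)
  show "integrable M (\<lambda>\<omega>. (X \<omega> $ i)\<^sup>2 + (Y \<omega> $ j)\<^sup>2)"
    using X Y by (simp add: square_integrable_def)
  show "(\<lambda>\<omega>. X \<omega> $ i * Y \<omega> $ j) \<in> borel_measurable M"
    using X Y by (intro borel_measurable_times borel_measurable_vec_nth_comp)
      (simp_all add: square_integrable_def)
  have "\<bar>a * b\<bar> \<le> a\<^sup>2 + b\<^sup>2" for a b :: real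
  proof -
    have "0 \<le> (\<bar>a\<bar> - \<bar>b\<bar>)\<^sup>2" "0 \<le> \<bar>a\<bar> * \<bar>b\<bar>" by simp_all
    then show ?thesis unfolding power2_diff abs_mult power2_abs by linarith
  qed
  then show "AE \<omega> in M. norm (X \<omega> $ i * Y \<omega> $ j) \<le> norm ((X \<omega> $ i)\<^sup>2 + (Y \<omega> $ j)\<^sup>2)"
    by simp
qed

lemma (in finite_measure) square_integrable_component:
  assumes X: "square_integrable M X"
  shows "integrable M (\<lambda>\<omega>. X \<omega> $ i)"
proof (rule Bochner_Integration.integrable_bound)
  show "integrable M (\<lambda>\<omega>. (X \<omega> $ i)\<^sup>2 + 1)"
    using X by (simp add: square_integrable_def)
  show "(\<lambda>\<omega>. X \<omega> $ i) \<in> borel_measurable M"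
    using X by (intro borel_measurable_vec_nth_comp) (simp add: square_integrable_def)
  have "\<bar>a\<bar> \<le> a\<^sup>2 + 1" for a :: real
  proof -
    have "0 \<le> (\<bar>a\<bar> - 1)\<^sup>2" by simp
    then have "2 * \<bar>a\<bar> \<le> a\<^sup>2 + 1" by (simp add: power2_diff)
    then show ?thesis by linarith
  qed
  then show "AE \<omega> in M. norm (X \<omega> $ i) \<le> norm ((X \<omega> $ i)\<^sup>2 + 1)"
    by simp
qed

lemma (in finite_measure) square_integrable_integrable:
  assumes X: "square_integrable M X"
  shows "integrable M X"
proof (rule Bochner_Integration.integrable_bound)
  show "integrable M (\<lambda>\<omega>. \<Sum>i\<in>UNIV. \<bar>X \<omega> $ i\<bar>)"
    using square_integrable_component[OF X] by simp
  show "AE \<omega> in M. norm (X \<omega>) \<le> norm (\<Sum>i\<in>UNIV. \<bar>X \<omega> $ i\<bar>)"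
    using norm_le_l1_cart by (auto simp: sum_nonneg)
qed (use X in \<open>simp add: square_integrable_def\<close>)

lemma integral_vec_nth:
  fixes X :: "'a \<Rightarrow> real^'n"
  assumes "integrable M X"
  shows "(\<integral>\<omega>. X \<omega> \<partial>M) $ i = (\<integral>\<omega>. X \<omega> $ i \<partial>M)"
  using integral_bounded_linear[OF bounded_linear_vec_nth assms] by simp

lemma square_integrable_add:
  assumes X: "square_integrable M X" and Y: "square_integrable M Y"
  shows "square_integrable M (\<lambda>\<omega>. X \<omega> + Y \<omega>)"
proof -
  have "integrable M (\<lambda>\<omega>. (X \<omega> $ i)\<^sup>2 + (Y \<omega> $ i)\<^sup>2 + 2 * (X \<omega> $ i * Y \<omega> $ i))" for i
    using X Y square_integrable_mult[OF X Y] by (simp add: square_integrable_def)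
  moreover have "(\<lambda>\<omega>. X \<omega> + Y \<omega>) \<in> borel_measurable M"
    by (intro borel_measurable_add square_integrable_measurable X Y)
  ultimately show ?thesis by (simp add: square_integrable_def power2_sum mult.assoc)
qed

lemma (in finite_measure) square_integrable_const: "square_integrable M (\<lambda>_. a)"
  by (simp add: square_integrable_def)

lemma square_integrable_matrix_vector:
  fixes A :: "real^'n^'m"
  assumes X: "square_integrable M X"
  shows "square_integrable M (\<lambda>\<omega>. A *v X \<omega>)"
proof -
  have "((A *v X \<omega>) $ i)\<^sup>2 =
      (\<Sum>j\<in>UNIV. \<Sum>k\<in>UNIV. A $ i $ j * A $ i $ k * (X \<omega> $ j * X \<omega> $ k))" for \<omega> i
    by (simp add: matrix_vector_mult_def power2_eq_square sum_product ac_simps)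
  then show ?thesis
    using X square_integrable_mult[OF X X]
    by (simp add: square_integrable_def borel_measurable_matrix_vector)
qed

lemma (in finite_measure) square_integrable_diff_const:
  assumes "square_integrable M X"
  shows "square_integrable M (\<lambda>\<omega>. X \<omega> - a)"
  using square_integrable_add[OF assms square_integrable_const[of "- a"]] by simp

lemma square_integrable_zero: "square_integrable M (\<lambda>_. 0)"
  by (simp add: square_integrable_def)

lemma square_integrable_sum:
  assumes "\<And>i. i \<in> I \<Longrightarrow> square_integrable M (X i)"
  shows "square_integrable M (\<lambda>\<omega>. \<Sum>i\<in>I. X i \<omega>)"
  using assms
  by (induction I rule: infinite_finite_induct) (auto simp: square_integrable_zero intro: square_integrable_add)

lemma transpose_second_moment: "transpose (second_moment M X Y) = second_moment M Y X"
  by (simp add: second_moment_def transpose_def mult.commute)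

lemma second_moment_matrix_left:
  fixes A :: "real^'n^'m"
  assumes X: "square_integrable M X" and Y: "square_integrable M Y"
  shows "second_moment M (\<lambda>\<omega>. A *v X \<omega>) Y = A ** second_moment M X Y"
proof -
  have "(A *v X \<omega>) $ i * Y \<omega> $ j = (\<Sum>k\<in>UNIV. A $ i $ k * (X \<omega> $ k * Y \<omega> $ j))" for \<omega> i j
    by (simp add: matrix_vector_mult_def sum_distrib_right mult.assoc)
  then show ?thesis
    using square_integrable_mult[OF X Y]
    by (simp add: second_moment_def matrix_matrix_mult_def vec_eq_iff)
qed

lemma second_moment_add_left:
  assumes "square_integrable M X" "square_integrable M Y" "square_integrable M Z"
  shows "second_moment M (\<lambda>\<omega>. X \<omega> + Y \<omega>) Z = second_moment M X Z + second_moment M Y Z"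
  using square_integrable_mult[OF assms(1,3)] square_integrable_mult[OF assms(2,3)]
  by (simp add: second_moment_def vec_eq_iff distrib_right)

lemma second_moment_matrix_right:
  fixes A :: "real^'n^'m"
  assumes X: "square_integrable M X" and Y: "square_integrable M Y"
  shows "second_moment M X (\<lambda>\<omega>. A *v Y \<omega>) = second_moment M X Y ** transpose A"
  using arg_cong[OF second_moment_matrix_left[OF Y X, of A], of transpose]
  by (simp add: transpose_second_moment matrix_transpose_mul)

lemma second_moment_add_right:
  assumes "square_integrable M X" "square_integrable M Y" "square_integrable M Z"
  shows "second_moment M Z (\<lambda>\<omega>. X \<omega> + Y \<omega>) = second_moment M Z X + second_moment M Z Y"
  using arg_cong[OF second_moment_add_left[OF assms], of transpose]
  by (simp add: transpose_second_moment transpose_add)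

lemma second_moment_sum_left:
  assumes "finite I" "\<And>i. i \<in> I \<Longrightarrow> square_integrable M (X i)" "square_integrable M Z"
  shows "second_moment M (\<lambda>\<omega>. \<Sum>i\<in>I. X i \<omega>) Z = (\<Sum>i\<in>I. second_moment M (X i) Z)"
  using assms
proof (induction I rule: finite_induct)
  case empty
  then show ?case by (simp add: second_moment_def vec_eq_iff)
next
  case (insert i I)
  then show ?case by (simp add: second_moment_add_left square_integrable_sum)
qed

lemma second_moment_sum_right:
  assumes "finite I" "\<And>i. i \<in> I \<Longrightarrow> square_integrable M (X i)" "square_integrable M Z"
  shows "second_moment M Z (\<lambda>\<omega>. \<Sum>i\<in>I. X i \<omega>) = (\<Sum>i\<in>I. second_moment M Z (X i))"
  using assms
proof (induction I rule: finite_induct)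
  case empty
  then show ?case by (simp add: second_moment_def vec_eq_iff)
next
  case (insert i I)
  then show ?case by (simp add: second_moment_add_right square_integrable_sum)
qed

text \<open>Evaluates the covariance of the shifted noise polynomial: whiteness deletes the
  off-diagonal terms of the double sum, which is why \<open>Qbar\<close> is a single sum.\<close>

lemma second_moment_linear_combination:
  fixes B :: "'i \<Rightarrow> real^'r^'n" and X :: "'i \<Rightarrow> 'a \<Rightarrow> real^'r"
  assumes I: "finite I" and X: "\<And>i. i \<in> I \<Longrightarrow> square_integrable M (X i)"
    and uncor: "\<And>i j. i \<in> I \<Longrightarrow> j \<in> I \<Longrightarrow> i \<noteq> j \<Longrightarrow> second_moment M (X i) (X j) = 0"
  shows "second_moment M (\<lambda>\<omega>. \<Sum>i\<in>I. B i *v X i \<omega>) (\<lambda>\<omega>. \<Sum>i\<in>I. B i *v X i \<omega>)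
    = (\<Sum>i\<in>I. B i ** second_moment M (X i) (X i) ** transpose (B i))"
proof -
  have BX: "i \<in> I \<Longrightarrow> square_integrable M (\<lambda>\<omega>. B i *v X i \<omega>)" for i
    by (intro square_integrable_matrix_vector X)
  have "second_moment M (\<lambda>\<omega>. \<Sum>i\<in>I. B i *v X i \<omega>) (\<lambda>\<omega>. \<Sum>i\<in>I. B i *v X i \<omega>)
    = (\<Sum>i\<in>I. \<Sum>j\<in>I. B i ** second_moment M (X i) (X j) ** transpose (B j))"
    using I X BX
    by (simp add: second_moment_sum_left second_moment_sum_right square_integrable_sum
        second_moment_matrix_left second_moment_matrix_right matrix_mul_assoc)
  also have "\<dots> = (\<Sum>i\<in>I. \<Sum>j\<in>I. if j = i then B i ** second_moment M (X i) (X i) ** transpose (B i) else 0)"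
    using uncor by (intro sum.cong refl) (auto simp: matrix_matrix_mult_def vec_eq_iff)
  also have "\<dots> = (\<Sum>i\<in>I. B i ** second_moment M (X i) (X i) ** transpose (B i))"
    using I by simp
  finally show ?thesis .
qed

lemma quadratic_form_second_moment:
  assumes X: "square_integrable M X"
  shows "x \<bullet> (second_moment M X X *v x) = (\<integral>\<omega>. (x \<bullet> X \<omega>)\<^sup>2 \<partial>M)"
proof -
  have "(x \<bullet> X \<omega>)\<^sup>2 = (\<Sum>i\<in>UNIV. \<Sum>j\<in>UNIV. x $ i * x $ j * (X \<omega> $ i * X \<omega> $ j))" for \<omega>
    by (simp add: inner_vec_def power2_eq_square sum_product ac_simps)
  then show ?thesis
    using square_integrable_mult[OF X X]
    by (simp add: second_moment_def matrix_vector_mult_def inner_vec_def sum_distrib_left ac_simps)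
qed

text \<open>Meant for the transmitted measurement noise, whose covariance may be degenerate a
  priori. The expectation of a square supplies semidefiniteness.\<close>

lemma second_moment_invertible_imp_pos_def:
  assumes "square_integrable M X" "invertible (second_moment M X X)"
  shows "pos_def (second_moment M X X)"
  using assms by (intro pos_semidef_invertible_imp_pos_def)
    (simp_all add: transpose_second_moment quadratic_form_second_moment)

section \<open>Moments under image and product measures\<close>

lemma square_integrable_distr:
  assumes T: "T \<in> measurable M L" and X: "X \<in> borel_measurable L"
  shows "square_integrable (distr M L T) X \<longleftrightarrow> square_integrable M (\<lambda>\<omega>. X (T \<omega>))"
proof -
  have "integrable (distr M L T) (\<lambda>\<omega>. (X \<omega> $ i)\<^sup>2) \<longleftrightarrow> integrable M (\<lambda>\<omega>. (X (T \<omega>) $ i)\<^sup>2)" for i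
    using T by (rule integrable_distr_eq) (intro borel_measurable_power borel_measurable_vec_nth_comp X)
  then show ?thesis
    using X measurable_compose[OF T X] by (simp add: square_integrable_def)
qed

lemma second_moment_distr:
  assumes T: "T \<in> measurable M L" and X: "X \<in> borel_measurable L" and Y: "Y \<in> borel_measurable L"
  shows "second_moment (distr M L T) X Y = second_moment M (\<lambda>\<omega>. X (T \<omega>)) (\<lambda>\<omega>. Y (T \<omega>))"
proof -
  have "(\<integral>\<omega>. X \<omega> $ i * Y \<omega> $ j \<partial>distr M L T) = (\<integral>\<omega>. X (T \<omega>) $ i * Y (T \<omega>) $ j \<partial>M)" for i j
    using T by (rule integral_distr)
      (intro borel_measurable_times borel_measurable_vec_nth_comp X Y)
  then show ?thesis by (simp add: second_moment_def vec_eq_iff)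
qed

context pair_prob_space
begin

lemma distr_snd: "distr (M1 \<Otimes>\<^sub>M M2) M2 snd = M2"
proof (intro measure_eqI)
  fix A assume A: "A \<in> sets (distr (M1 \<Otimes>\<^sub>M M2) M2 snd)"
  then have "emeasure (distr (M1 \<Otimes>\<^sub>M M2) M2 snd) A = emeasure (M1 \<Otimes>\<^sub>M M2) (space M1 \<times> A)"
    by (auto simp: emeasure_distr space_pair_measure dest: sets.sets_into_space
        intro!: arg_cong2[where f=emeasure])
  also have "\<dots> = emeasure M2 A"
    using A by (simp add: M2.emeasure_pair_measure_Times M1.emeasure_space_1)
  finally show "emeasure (distr (M1 \<Otimes>\<^sub>M M2) M2 snd) A = emeasure M2 A" .
qed simp

lemma square_integrable_fst:
  "square_integrable M1 X \<Longrightarrow> square_integrable (M1 \<Otimes>\<^sub>M M2) (\<lambda>s. X (fst s))"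
  using square_integrable_distr[of fst "M1 \<Otimes>\<^sub>M M2" M1 X]
  by (simp add: M2.distr_pair_fst square_integrable_measurable)

lemma square_integrable_snd:
  "square_integrable M2 X \<Longrightarrow> square_integrable (M1 \<Otimes>\<^sub>M M2) (\<lambda>s. X (snd s))"
  using square_integrable_distr[of snd "M1 \<Otimes>\<^sub>M M2" M2 X]
  by (simp add: distr_snd square_integrable_measurable)

lemma second_moment_fst:
  "square_integrable M1 X \<Longrightarrow> square_integrable M1 Y \<Longrightarrow>
    second_moment (M1 \<Otimes>\<^sub>M M2) (\<lambda>s. X (fst s)) (\<lambda>s. Y (fst s)) = second_moment M1 X Y"
  using second_moment_distr[of fst "M1 \<Otimes>\<^sub>M M2" M1 X Y]
  by (simp add: M2.distr_pair_fst square_integrable_measurable)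

lemma second_moment_snd:
  "square_integrable M2 X \<Longrightarrow> square_integrable M2 Y \<Longrightarrow>
    second_moment (M1 \<Otimes>\<^sub>M M2) (\<lambda>s. X (snd s)) (\<lambda>s. Y (snd s)) = second_moment M2 X Y"
  using second_moment_distr[of snd "M1 \<Otimes>\<^sub>M M2" M2 X Y]
  by (simp add: distr_snd square_integrable_measurable)

text \<open>By Fubini with the second coordinate innermost, the inner integral is a multiple of the
  mean of \<open>Y\<close>.\<close>

lemma second_moment_fst_snd:
  assumes X: "square_integrable M1 X" and Y: "square_integrable M2 Y" and mean: "(\<integral>\<omega>. Y \<omega> \<partial>M2) = 0"
  shows "second_moment (M1 \<Otimes>\<^sub>M M2) (\<lambda>s. X (fst s)) (\<lambda>s. Y (snd s)) = 0"
proof -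
  have "(\<integral>s. X (fst s) $ i * Y (snd s) $ j \<partial>(M1 \<Otimes>\<^sub>M M2)) = 0" for i j
  proof -
    have int: "integrable (M1 \<Otimes>\<^sub>M M2) (\<lambda>s. X (fst s) $ i * Y (snd s) $ j)"
      by (intro square_integrable_mult square_integrable_fst square_integrable_snd X Y)
    have "(\<integral>y. Y y $ j \<partial>M2) = 0"
      using integral_vec_nth[OF M2.square_integrable_integrable[OF Y], of j] mean by simp
    then show ?thesis
      using integral_fst'[OF int] by simp
  qed
  then show ?thesis by (simp add: second_moment_def vec_eq_iff)
qed

lemma second_moment_snd_fst:
  assumes "square_integrable M1 X" "square_integrable M2 Y" "(\<integral>\<omega>. Y \<omega> \<partial>M2) = 0"
  shows "second_moment (M1 \<Otimes>\<^sub>M M2) (\<lambda>s. Y (snd s)) (\<lambda>s. X (fst s)) = 0"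
  using arg_cong[OF second_moment_fst_snd[OF assms], of transpose]
  by (simp add: transpose_second_moment) (simp add: transpose_def vec_eq_iff)

lemma integral_fst_comp:
  fixes X :: "'a \<Rightarrow> real^'n"
  shows "X \<in> borel_measurable M1 \<Longrightarrow> (\<integral>s. X (fst s) \<partial>(M1 \<Otimes>\<^sub>M M2)) = (\<integral>\<omega>. X \<omega> \<partial>M1)"
  using integral_distr[of fst "M1 \<Otimes>\<^sub>M M2" M1 X] by (simp add: M2.distr_pair_fst)

lemma integral_snd_comp:
  fixes X :: "'b \<Rightarrow> real^'n"
  shows "X \<in> borel_measurable M2 \<Longrightarrow> (\<integral>s. X (snd s) \<partial>(M1 \<Otimes>\<^sub>M M2)) = (\<integral>\<omega>. X \<omega> \<partial>M2)"
  using integral_distr[of snd "M1 \<Otimes>\<^sub>M M2" M2 X] by (simp add: distr_snd)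

text \<open>Serves twice: for the prediction, with the state matrix and the process noise, and for
  the innovation, with the measurement matrix and the measurement noise.\<close>

lemma second_moment_linear_plus_noise:
  fixes A :: "real^'n^'m" and X :: "'a \<Rightarrow> real^'n" and Y :: "'b \<Rightarrow> real^'m"
  assumes X: "square_integrable M1 X" and Y: "square_integrable M2 Y" and mean: "(\<integral>\<omega>. Y \<omega> \<partial>M2) = 0"
  shows "square_integrable (M1 \<Otimes>\<^sub>M M2) (\<lambda>s. A *v X (fst s) + Y (snd s))"
    and "second_moment (M1 \<Otimes>\<^sub>M M2) (\<lambda>s. A *v X (fst s) + Y (snd s)) (\<lambda>s. A *v X (fst s) + Y (snd s))
      = A ** second_moment M1 X X ** transpose A + second_moment M2 Y Y"
    and "second_moment (M1 \<Otimes>\<^sub>M M2) (\<lambda>s. X (fst s)) (\<lambda>s. A *v X (fst s) + Y (snd s))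
      = second_moment M1 X X ** transpose A"
proof -
  note si = square_integrable_fst[OF X] square_integrable_snd[OF Y]
    square_integrable_matrix_vector[OF square_integrable_fst[OF X], of A]
  show "square_integrable (M1 \<Otimes>\<^sub>M M2) (\<lambda>s. A *v X (fst s) + Y (snd s))"
    by (intro square_integrable_add si)
  note sum = this
  show "second_moment (M1 \<Otimes>\<^sub>M M2) (\<lambda>s. A *v X (fst s) + Y (snd s)) (\<lambda>s. A *v X (fst s) + Y (snd s))
      = A ** second_moment M1 X X ** transpose A + second_moment M2 Y Y"
    using assms
    by (simp add: second_moment_add_left second_moment_add_right second_moment_matrix_left
        second_moment_matrix_right si sum second_moment_fst second_moment_snd second_moment_fst_snd
        second_moment_snd_fst matrix_mul_assoc)
  show "second_moment (M1 \<Otimes>\<^sub>M M2) (\<lambda>s. X (fst s)) (\<lambda>s. A *v X (fst s) + Y (snd s))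
      = second_moment M1 X X ** transpose A"
    using assms
    by (simp add: second_moment_add_right second_moment_matrix_right si second_moment_fst
        second_moment_fst_snd)
qed

end

text \<open>Testing the definition with coordinate vectors reduces the claim to one-dimensional
  laws, a point mass or a normal distribution.\<close>

lemma gaussian_vector_square_integrable:
  assumes "gaussian_vector M X"
  shows "square_integrable M X"
proof -
  have meas: "X \<in> borel_measurable M" using assms by (simp add: gaussian_vector_def)
  have "integrable M (\<lambda>\<omega>. (X \<omega> $ i)\<^sup>2)" for i
  proof -
    have comp: "axis i 1 \<bullet> X \<omega> = X \<omega> $ i" for \<omega> by (simp add: inner_axis')
    have Xi: "(\<lambda>\<omega>. X \<omega> $ i) \<in> measurable M borel" using meas by (rule borel_measurable_vec_nth_comp)
    from assms consider m where "distr M borel (\<lambda>\<omega>. X \<omega> $ i) = return borel m"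
      | m s where "0 < s" "distributed M lborel (\<lambda>\<omega>. X \<omega> $ i) (normal_density m s)"
      unfolding gaussian_vector_def comp[symmetric] by metis
    then show ?thesis
    proof cases
      case 1
      have "integrable (return borel m) (\<lambda>x. x\<^sup>2)"
        by (simp add: integrable_iff_bounded nn_integral_return)
      then show ?thesis
        using integrable_distr_eq[OF Xi, of "\<lambda>x. x\<^sup>2"] 1 by simp
    next
      case 2
      \<comment> \<open>Central moments are known to be integrable, so \<open>x\<^sup>2\<close> is
        expanded in the powers 2, 1 and 0 of \<open>x - m\<close>.\<close>
      have "integrable lborel (\<lambda>x. normal_density m s x * (x - m)^2 +
          (2 * m * (normal_density m s x * (x - m)^1) + m\<^sup>2 * (normal_density m s x * (x - m)^0)))"
        using 2(1) by (intro Bochner_Integration.integrable_add integrable_mult_right integrable_normal_moment)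
      moreover have "normal_density m s x * (x - m)^2 +
          (2 * m * (normal_density m s x * (x - m)^1) + m\<^sup>2 * (normal_density m s x * (x - m)^0))
          = normal_density m s x * x\<^sup>2" for x
        by (simp add: power2_eq_square algebra_simps)
      ultimately have "integrable lborel (\<lambda>x. normal_density m s x * x\<^sup>2)" by simp
      then show ?thesis
        using distributed_integrable[OF 2(2), of "\<lambda>x. x\<^sup>2"] by simp
    qed
  qed
  with meas show ?thesis by (simp add: square_integrable_def)
qed

section \<open>Moments of Gaussian weights\<close>

lemma lborel_distr_reflect:
  fixes a :: "'a::euclidean_space"
  shows "distr lborel borel (\<lambda>x. a - x) = lborel"
  using lborel_affine[of "-1" a] by (simp add: density_1)

lemma lborel_distr_translate:
  fixes a :: "'a::euclidean_space"
  shows "distr lborel borel (\<lambda>x. x + a) = lborel"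
  using lborel_distr_plus[of a] by (simp add: add.commute[of _ a])

lemma lborel_integral_translate:
  fixes f :: "'a::euclidean_space \<Rightarrow> real"
  assumes "f \<in> borel_measurable borel"
  shows "(\<integral>x. f (x + a) \<partial>lborel) = (\<integral>x. f x \<partial>lborel)"
  using integral_distr[of "\<lambda>x. x + a" lborel borel f] assms by (simp add: lborel_distr_translate)

lemma lborel_integrable_translate:
  fixes f :: "'a::euclidean_space \<Rightarrow> real"
  assumes "f \<in> borel_measurable borel"
  shows "integrable lborel (\<lambda>x. f (x + a)) \<longleftrightarrow> integrable lborel f"
  using integrable_distr_eq[of "\<lambda>x. x + a" lborel borel f] assms by (simp add: lborel_distr_translate)

lemma lborel_integral_reflect:
  fixes f :: "'a::euclidean_space \<Rightarrow> real"
  assumes "f \<in> borel_measurable borel"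
  shows "(\<integral>x. f (a - x) \<partial>lborel) = (\<integral>x. f x \<partial>lborel)"
  using integral_distr[of "\<lambda>x. a - x" lborel borel f] assms by (simp add: lborel_distr_reflect)

lemma lborel_nn_integral_reflect:
  fixes f :: "'a::euclidean_space \<Rightarrow> ennreal"
  assumes "f \<in> borel_measurable borel"
  shows "(\<integral>\<^sup>+x. f (a - x) \<partial>lborel) = (\<integral>\<^sup>+x. f x \<partial>lborel)"
  using nn_integral_distr[of "\<lambda>x. a - x" lborel borel f] assms by (simp add: lborel_distr_reflect)

text \<open>The squared norm is a sum over the basis, so the exponential is a product and its
  integral factors into one-dimensional ones. The deviation \<open>?s\<close> satisfies
  \<open>1 / (2 * ?s\<^sup>2) = c\<close>, which makes each factor a multiple of a normal
  density.\<close>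

lemma integrable_exp_norm_square:
  fixes c :: real
  assumes c: "0 < c"
  shows "integrable lborel (\<lambda>x::'a::euclidean_space. exp (- c * (norm x)\<^sup>2))"
proof -
  let ?s = "1 / sqrt (2 * c)"
  have scale: "normal_density 0 ?s t = exp (- c * t\<^sup>2) * normal_density 0 ?s 0" for t
    using c by (simp add: normal_density_def power_divide field_simps)
  have "normal_density 0 ?s 0 > 0" using c by (intro normal_density_pos) simp
  then have eq: "exp (- c * t\<^sup>2) = normal_density 0 ?s t * inverse (normal_density 0 ?s 0)" for t
    using scale[of t] by (metis divide_inverse less_irrefl nonzero_mult_div_cancel_right)
  have 1: "integrable lborel (\<lambda>t::real. exp (- c * t\<^sup>2))"
    unfolding eq using c by (intro integrable_mult_left integrable_normal_density) simp
  have "(\<integral>\<^sup>+x. ennreal (exp (- c * (norm (x::'a))\<^sup>2)) \<partial>lborel)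
      = (\<integral>\<^sup>+x. (\<Prod>b\<in>(Basis::'a set). ennreal (exp (- c * (x \<bullet> b)\<^sup>2))) \<partial>lborel)"
  proof (intro nn_integral_cong)
    fix x :: 'a
    have "(norm x)\<^sup>2 = (\<Sum>b\<in>Basis. (x \<bullet> b)\<^sup>2)"
      by (subst power2_norm_eq_inner, subst euclidean_inner) (simp add: power2_eq_square)
    then have "exp (- c * (norm x)\<^sup>2) = (\<Prod>b\<in>Basis. exp (- c * (x \<bullet> b)\<^sup>2))"
      by (simp only: sum_distrib_left exp_sum[OF finite_Basis])
    then show "ennreal (exp (- c * (norm x)\<^sup>2)) = (\<Prod>b\<in>Basis. ennreal (exp (- c * (x \<bullet> b)\<^sup>2)))"
      by (simp only: prod_ennreal[OF exp_ge_zero])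
  qed
  also have "\<dots> = (\<Prod>b\<in>(Basis::'a set). \<integral>\<^sup>+t. ennreal (exp (- c * t\<^sup>2)) \<partial>lborel)"
    by (rule nn_integral_lborel_prod) auto
  also have "\<dots> < \<infinity>"
    using 1 by (auto simp: integrable_iff_bounded less_top[symmetric] power_eq_top_ennreal)
  finally show ?thesis by (auto simp: integrable_iff_bounded)
qed

text \<open>A centred Gaussian weight given by its precision matrix. Positivity is not built in,
  since the matrix left after division by the likelihood is shown to be positive definite only
  afterwards.\<close>

definition quad_weight :: "real^'n^'n \<Rightarrow> real^'n \<Rightarrow> real" where
  "quad_weight J x = exp (- (1/2) * (x \<bullet> (J *v x)))"

lemma quad_weight_pos: "0 < quad_weight J x"
  by (simp add: quad_weight_def)

lemma borel_measurable_quad_weight [measurable]: "quad_weight J \<in> borel_measurable borel"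
  unfolding quad_weight_def by (intro borel_measurable_continuous_onI continuous_intros)

lemma quad_weight_minus: "quad_weight J (- x) = quad_weight J x"
  using matrix_vector_mult_scaleR[of J "-1" x] by (simp add: quad_weight_def)

lemma quad_weight_translate:
  assumes "transpose J = J"
  shows "quad_weight J (x + u) = quad_weight J x * exp (- (x \<bullet> (J *v u)) - (1/2) * (u \<bullet> (J *v u)))"
  using symmetric_inner_commute[OF assms, of u x]
  by (simp add: quad_weight_def exp_add[symmetric] matrix_vector_right_distrib inner_add_left inner_add_right
      algebra_simps)

lemma integrable_quad_weight_bound:
  fixes g :: "real^'n \<Rightarrow> real"
  assumes J: "pos_def J" and g: "g \<in> borel_measurable borel"
    and bound: "\<And>x. \<bar>g x\<bar> \<le> C * exp (K * norm x)"
  shows "integrable lborel (\<lambda>x. g x * quad_weight J x)"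
proof -
  from pos_def_coercive[OF J] obtain c where c: "0 < c" "\<And>x. c * (norm x)\<^sup>2 \<le> x \<bullet> (J *v x)"
    by metis
  have "0 \<le> C" using bound[of 0] by simp
  have dom: "\<bar>g x * quad_weight J x\<bar> \<le> C * exp (K\<^sup>2 / c) * exp (- (c / 4) * (norm x)\<^sup>2)" for x
  proof -
    \<comment> \<open>Completing the square: of the \<open>c / 2\<close> available in the exponent,
      one \<open>c / 4\<close> absorbs the linear term \<open>K * norm x\<close> and the other is
      left for the decay.\<close>
    have "0 \<le> c / 4 * (norm x - 2 * K / c)\<^sup>2" using c by simp
    also have "\<dots> = c / 4 * (norm x)\<^sup>2 - K * norm x + K\<^sup>2 / c"
      using c by (simp add: power2_diff field_simps power2_eq_square)
    finally have "K * norm x - (1/2) * (x \<bullet> (J *v x)) \<le> K\<^sup>2 / c - (c / 4) * (norm x)\<^sup>2"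
      using c(2)[of x] by simp
    then have "exp (K * norm x) * quad_weight J x \<le> exp (K\<^sup>2 / c) * exp (- (c / 4) * (norm x)\<^sup>2)"
      by (simp add: quad_weight_def exp_add[symmetric])
    moreover have "\<bar>g x * quad_weight J x\<bar> \<le> C * exp (K * norm x) * quad_weight J x"
      using bound[of x] quad_weight_pos[of J x] by (simp add: abs_mult)
    ultimately show ?thesis using \<open>0 \<le> C\<close>
      by (smt (verit) mult.assoc mult_left_mono)
  qed
  show ?thesis
  proof (rule Bochner_Integration.integrable_bound)
    show "integrable lborel (\<lambda>x::real^'n. C * exp (K\<^sup>2 / c) * exp (- (c / 4) * (norm x)\<^sup>2))"
      using c by (intro integrable_mult_right integrable_exp_norm_square) simp
    show "(\<lambda>x. g x * quad_weight J x) \<in> borel_measurable lborel" using g by simp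
    show "AE x in lborel. norm (g x * quad_weight J x)
        \<le> norm (C * exp (K\<^sup>2 / c) * exp (- (c / 4) * (norm x)\<^sup>2))"
      using dom \<open>0 \<le> C\<close> by (intro AE_I2) (simp add: abs_mult)
  qed
qed

lemma inner_le_exp_norm: "\<bar>w \<bullet> x\<bar> \<le> norm w * exp (norm x)" for x :: "'a::real_inner"
proof -
  have "\<bar>w \<bullet> x\<bar> \<le> norm w * norm x" by (rule Cauchy_Schwarz_ineq2)
  also have "norm x \<le> exp (norm x)" using exp_ge_add_one_self[of "norm x"] by linarith
  finally show ?thesis by (simp add: mult_left_mono)
qed

lemma borel_measurable_inner_left [measurable]:
  "(\<lambda>x::real^'n. w \<bullet> x) \<in> borel_measurable borel" "(\<lambda>x::real^'n. x \<bullet> w) \<in> borel_measurable borel"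
  by (intro borel_measurable_continuous_onI continuous_intros)+

lemma quad_weight_integrable:
  assumes J: "pos_def J"
  shows "integrable lborel (quad_weight J)"
    and "integrable lborel (\<lambda>x. (w \<bullet> x) * quad_weight J x)"
    and "integrable lborel (\<lambda>x. (w \<bullet> x) * (v \<bullet> x) * quad_weight J x)"
proof -
  have "\<bar>1 :: real\<bar> \<le> 1 * exp (0 * norm x)" for x :: "real^'n" by simp
  from integrable_quad_weight_bound[OF J _ this] show "integrable lborel (quad_weight J)" by simp
  have "\<bar>w \<bullet> x\<bar> \<le> norm w * exp (1 * norm x)" for x using inner_le_exp_norm by simp
  from integrable_quad_weight_bound[OF J _ this] show "integrable lborel (\<lambda>x. (w \<bullet> x) * quad_weight J x)"
    by simp
  have "\<bar>(w \<bullet> x) * (v \<bullet> x)\<bar> \<le> (norm w * norm v) * exp (2 * norm x)" for x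
    using mult_mono[OF inner_le_exp_norm[of w x] inner_le_exp_norm[of v x]]
    by (simp only: abs_mult mult_2 distrib_right exp_add) (simp add: ac_simps)
  from integrable_quad_weight_bound[OF J _ this]
  show "integrable lborel (\<lambda>x. (w \<bullet> x) * (v \<bullet> x) * quad_weight J x)" by simp
qed

lemma quad_weight_first_moment: "(\<integral>x. (w \<bullet> x) * quad_weight J x \<partial>lborel) = 0"
proof -
  have "(\<integral>x. (w \<bullet> x) * quad_weight J x \<partial>lborel) = (\<integral>x. (w \<bullet> (0 - x)) * quad_weight J (0 - x) \<partial>lborel)"
    by (rule lborel_integral_reflect[symmetric]) measurable
  also have "\<dots> = - (\<integral>x. (w \<bullet> x) * quad_weight J x \<partial>lborel)"
    by (simp add: quad_weight_minus)
  finally show ?thesis by simp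
qed

text \<open>Provides domination for the difference quotients in Stein's identity: with
  \<open>y\<close> of the form \<open>- t * s\<close>, division by \<open>t\<close> leaves a bound
  that stays finite as \<open>t\<close> tends to 0.\<close>

lemma abs_exp_minus_one_le: "\<bar>exp y - 1\<bar> \<le> \<bar>y\<bar> * exp \<bar>y\<bar>" for y :: real
proof (cases "0 \<le> y")
  case True
  have "(1 - y) \<le> exp (- y)" using exp_ge_add_one_self[of "- y"] by simp
  then have "exp y * (1 - y) \<le> exp y * exp (- y)" by (rule mult_left_mono) simp
  then have "exp y * (1 - y) \<le> 1" by (simp add: exp_minus)
  then show ?thesis using True by (simp add: algebra_simps)
next
  case False
  have "1 + y \<le> exp y" by (rule exp_ge_add_one_self)
  moreover have "exp y \<le> 1" using False by simp
  moreover have "\<bar>y\<bar> * 1 \<le> \<bar>y\<bar> * exp \<bar>y\<bar>" by (intro mult_left_mono) auto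
  ultimately show ?thesis using False by linarith
qed

text \<open>Stein's identity, obtained by differentiating the integral of (w . x) quad_weight J x along the
  translations by t u, under which it is constant.\<close>
lemma quad_weight_stein:
  fixes J :: "real^'n^'n"
  assumes J: "pos_def J"
  shows "(\<integral>x. (w \<bullet> x) * ((J *v u) \<bullet> x) * quad_weight J x \<partial>lborel) = (w \<bullet> u) * (\<integral>x. quad_weight J x \<partial>lborel)"
proof -
  let ?s = "\<lambda>x. (J *v u) \<bullet> x" and ?g = "quad_weight J"
  let ?K = "norm (J *v u)"
  define t where "t n = 1 / real (Suc n)" for n
  have t: "0 < t n" "t n \<le> 1" for n by (auto simp: t_def)
  have t0: "t \<longlonglongrightarrow> 0" unfolding t_def by (rule LIMSEQ_Suc[OF lim_1_over_n])
  \<comment> \<open>A difference quotient of \<open>(w \<bullet> x) * ?g x\<close> along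
    \<open>t n *\<^sub>R u\<close> in which the translated term is multiplied by the constant
    \<open>e\<close> below. This removes the factor of second order in \<open>t n\<close> from the
    translated weight, and it is harmless because the integral of both terms is 0.\<close>
  define G where "G n x = ((w \<bullet> x) * ((exp (- t n * ?s x) - 1) / t n) + (w \<bullet> u) * exp (- t n * ?s x)) * ?g x"
    for n x
  \<comment> \<open>In the exponent, 2 accounts for the two linear forms, each bounded by an
    exponential of the norm, and \<open>?K\<close> for the translation factor, using
    \<open>t n \<le> 1\<close>.\<close>
  define B where "B x = norm w * ?K * exp ((2 + ?K) * norm x) * ?g x
      + \<bar>w \<bullet> u\<bar> * exp ((2 + ?K) * norm x) * ?g x" for x
  have exp_le: "exp \<bar>- t n * ?s x\<bar> \<le> exp (?K * norm x)" for n x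
  proof -
    have "\<bar>- t n * ?s x\<bar> \<le> 1 * (?K * norm x)"
      unfolding abs_mult using t[of n] Cauchy_Schwarz_ineq2[of "J *v u" x]
      by (intro mult_mono) auto
    then show ?thesis by simp
  qed
  have bound: "\<bar>G n x\<bar> \<le> B x" for n x
  proof -
    have "\<bar>(exp (- t n * ?s x) - 1) / t n\<bar> \<le> (\<bar>- t n * ?s x\<bar> * exp \<bar>- t n * ?s x\<bar>) / t n"
      using t[of n] abs_exp_minus_one_le[of "- t n * ?s x"] by (simp add: divide_right_mono)
    also have "\<dots> = \<bar>?s x\<bar> * exp \<bar>- t n * ?s x\<bar>" using t[of n] by (simp add: abs_mult)
    also have "\<dots> \<le> (?K * exp (norm x)) * exp (?K * norm x)"
      by (intro mult_mono inner_le_exp_norm exp_le) auto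
    finally have "\<bar>(w \<bullet> x) * ((exp (- t n * ?s x) - 1) / t n)\<bar>
        \<le> (norm w * exp (norm x)) * ((?K * exp (norm x)) * exp (?K * norm x))"
      unfolding abs_mult[of "w \<bullet> x"] by (intro mult_mono inner_le_exp_norm) auto
    also have "\<dots> = norm w * ?K * exp ((2 + ?K) * norm x)"
      by (simp add: exp_add distrib_right exp_double power2_eq_square)
    finally have 1: "\<bar>(w \<bullet> x) * ((exp (- t n * ?s x) - 1) / t n)\<bar> \<le> norm w * ?K * exp ((2 + ?K) * norm x)" .
    have "exp (- t n * ?s x) \<le> exp \<bar>- t n * ?s x\<bar>" by simp
    also have "\<dots> \<le> exp (?K * norm x)" by (rule exp_le)
    also have "\<dots> \<le> exp ((2 + ?K) * norm x)" by (simp add: distrib_right)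
    finally have 2: "\<bar>(w \<bullet> u) * exp (- t n * ?s x)\<bar> \<le> \<bar>w \<bullet> u\<bar> * exp ((2 + ?K) * norm x)"
      by (simp add: abs_mult mult_left_mono)
    have "\<bar>(w \<bullet> x) * ((exp (- t n * ?s x) - 1) / t n) + (w \<bullet> u) * exp (- t n * ?s x)\<bar>
        \<le> norm w * ?K * exp ((2 + ?K) * norm x) + \<bar>w \<bullet> u\<bar> * exp ((2 + ?K) * norm x)"
      using 1 2 by linarith
    from mult_right_mono[OF this less_imp_le[OF quad_weight_pos[of J x]]]
    show ?thesis by (simp only: G_def B_def distrib_right[symmetric] abs_mult[of _ "?g x"]
        abs_of_pos[OF quad_weight_pos])
  qed
  have meas: "G n \<in> borel_measurable borel" for n
    unfolding G_def by measurable
  have "integrable lborel B"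
    unfolding B_def
    by (intro Bochner_Integration.integrable_add
        integrable_quad_weight_bound[OF J, where C = "norm w * ?K" and K = "2 + ?K"]
        integrable_quad_weight_bound[OF J, where C = "\<bar>w \<bullet> u\<bar>" and K = "2 + ?K"])
      (auto simp: abs_mult)
  moreover have "AE x in lborel. (\<lambda>n. G n x) \<longlonglongrightarrow> (- ((w \<bullet> x) * ?s x) + w \<bullet> u) * ?g x"
  proof (rule AE_I2)
    fix x
    have "((\<lambda>h. exp (h * - ?s x)) has_real_derivative - ?s x) (at 0)"
      by (auto intro!: derivative_eq_intros)
    then have "((\<lambda>h. (exp (h * - ?s x) - 1) / h) \<longlongrightarrow> - ?s x) (at 0)"
      by (simp add: DERIV_def)
    moreover have "filterlim t (at 0) sequentially"
      using t0 t by (auto simp: filterlim_at intro!: always_eventually) (metis less_irrefl)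
    ultimately have "(\<lambda>n. (exp (t n * - ?s x) - 1) / t n) \<longlonglongrightarrow> - ?s x"
      by (rule filterlim_compose)
    then have 1: "(\<lambda>n. (exp (- t n * ?s x) - 1) / t n) \<longlonglongrightarrow> - ?s x" by simp
    have "(\<lambda>n. exp (- t n * ?s x)) \<longlonglongrightarrow> exp (- 0 * ?s x)"
      by (intro tendsto_intros t0)
    then have "(\<lambda>n. G n x) \<longlonglongrightarrow> ((w \<bullet> x) * (- ?s x) + (w \<bullet> u) * 1) * ?g x"
      unfolding G_def by (intro tendsto_intros 1) simp
    then show "(\<lambda>n. G n x) \<longlonglongrightarrow> (- ((w \<bullet> x) * ?s x) + w \<bullet> u) * ?g x" by simp
  qed
  ultimately have lim: "(\<lambda>n. \<integral>x. G n x \<partial>lborel) \<longlonglongrightarrow> (\<integral>x. (- ((w \<bullet> x) * ?s x) + w \<bullet> u) * ?g x \<partial>lborel)"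
    using bound meas by (intro integral_dominated_convergence[where w = B]) auto
  have "(\<integral>x. G n x \<partial>lborel) = 0" for n
  proof -
    have 0: "integrable lborel (\<lambda>x. (w \<bullet> (x + t n *\<^sub>R u)) * ?g (x + t n *\<^sub>R u))"
      using quad_weight_integrable(2)[OF J, of w]
      by (subst lborel_integrable_translate) simp_all
    define e where "e = exp ((1/2) * (t n * t n * (u \<bullet> (J *v u))))"
    have G_eq: "G n x = (e / t n) * ((w \<bullet> (x + t n *\<^sub>R u)) * ?g (x + t n *\<^sub>R u)) - (1 / t n) * ((w \<bullet> x) * ?g x)" for x
    proof -
      have "e * ?g (x + t n *\<^sub>R u) = exp (- t n * ?s x) * ?g x"
      proof -
        have "- (x \<bullet> (J *v (t n *\<^sub>R u))) - (1/2) * ((t n *\<^sub>R u) \<bullet> (J *v (t n *\<^sub>R u)))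
            = - t n * ?s x - (1/2) * (t n * t n * (u \<bullet> (J *v u)))"
          by (simp add: matrix_vector_mult_scaleR inner_commute[of x])
        then show ?thesis
          unfolding e_def quad_weight_translate[OF pos_def_symmetric[OF J]] by (simp add: exp_diff)
      qed
      then have "(e / t n) * ((w \<bullet> (x + t n *\<^sub>R u)) * ?g (x + t n *\<^sub>R u))
          = (w \<bullet> (x + t n *\<^sub>R u)) / t n * (exp (- t n * ?s x) * ?g x)"
        by (simp only: times_divide_eq_left times_divide_eq_right mult.assoc mult.left_commute[of e])
      then show ?thesis
        using t(1)[of n] by (simp add: G_def inner_add_right field_simps)
    qed
    show ?thesis
      unfolding G_eq using 0 quad_weight_integrable(2)[OF J, of w]
        lborel_integral_translate[of "\<lambda>x. (w \<bullet> x) * ?g x" "t n *\<^sub>R u"]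
      by (simp add: quad_weight_first_moment)
  qed
  with lim have "(\<integral>x. (- ((w \<bullet> x) * ?s x) + w \<bullet> u) * ?g x \<partial>lborel) = 0"
    by (simp add: LIMSEQ_const_iff)
  moreover have "(\<integral>x. (- ((w \<bullet> x) * ?s x) + w \<bullet> u) * ?g x \<partial>lborel)
      = (w \<bullet> u) * (\<integral>x. ?g x \<partial>lborel) - (\<integral>x. (w \<bullet> x) * ?s x * ?g x \<partial>lborel)"
    using quad_weight_integrable(1)[OF J] quad_weight_integrable(3)[OF J, of w "J *v u"]
    by (simp add: distrib_right left_diff_distrib)
  ultimately show ?thesis by simp
qed

section \<open>Normalized Gaussian densities\<close>

lemma AE_lborel_False: "\<not> (AE x in (lborel :: 'a::euclidean_space measure). False)"
  by (simp add: eventually_False ae_filter_eq_bot_iff)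

lemma lborel_integral_pos:
  fixes f :: "'a::euclidean_space \<Rightarrow> real"
  assumes "integrable lborel f" "\<And>x. 0 < f x"
  shows "0 < (\<integral>x. f x \<partial>lborel)"
proof -
  have "(\<integral>x. f x \<partial>lborel) \<noteq> 0"
    using integral_nonneg_eq_0_iff_AE[OF assms(1)] assms(2) AE_lborel_False
    by (auto simp: less_imp_le less_imp_neq[symmetric])
  moreover have "0 \<le> (\<integral>x. f x \<partial>lborel)"
    using assms(2) by (simp add: less_imp_le)
  ultimately show ?thesis by simp
qed

lemma emeasure_normalized:
  assumes f: "f \<in> borel_measurable borel" "\<And>x. 0 \<le> f x" and pos: "0 < (\<integral>x. f x \<partial>lborel)"
    and T: "T \<in> sets borel"
  shows "emeasure (normalized f) T
    = (\<integral>\<^sup>+x. ennreal (f x) * indicator T x \<partial>lborel) / ennreal (\<integral>x. f x \<partial>lborel)"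
proof -
  have "emeasure (normalized f) T
      = (\<integral>\<^sup>+x. ennreal (f x) * indicator T x / ennreal (\<integral>x. f x \<partial>lborel) \<partial>lborel)"
    using f pos T unfolding normalized_def
    by (subst emeasure_density) (auto intro!: nn_integral_cong simp: divide_ennreal[symmetric]
        ennreal_times_divide ac_simps)
  then show ?thesis using f T by (simp add: nn_integral_divide)
qed

lemma prob_space_normalized:
  assumes f: "integrable lborel f" "\<And>x. 0 \<le> f x" and pos: "0 < (\<integral>x. f x \<partial>lborel)"
  shows "prob_space (normalized f)"
proof
  have "emeasure (normalized f) UNIV = 1"
    using assms by (subst emeasure_normalized)
      (auto dest: borel_measurable_integrable simp: nn_integral_eq_integral ennreal_divide_self)
  then show "emeasure (normalized f) (space (normalized f)) = 1" by (simp add: normalized_def)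
qed

lemma sets_normalized [simp, measurable_cong]: "sets (normalized f) = sets borel"
  by (simp add: normalized_def)

lemma space_normalized [simp]: "space (normalized f) = UNIV"
  by (simp add: normalized_def)

lemma normalized_integral:
  fixes g :: "real^'n \<Rightarrow> real"
  assumes f: "f \<in> borel_measurable borel" "\<And>x. 0 \<le> f x" and pos: "0 < (\<integral>x. f x \<partial>lborel)"
    and g: "g \<in> borel_measurable borel"
  shows "integrable (normalized f) g \<longleftrightarrow> integrable lborel (\<lambda>x. g x * f x)"
    and "(\<integral>x. g x \<partial>normalized f) = (\<integral>x. g x * f x \<partial>lborel) / (\<integral>x. f x \<partial>lborel)"
proof -
  let ?c = "\<integral>x. f x \<partial>lborel"
  have "integrable (normalized f) g \<longleftrightarrow> integrable lborel (\<lambda>x. f x / ?c * g x)"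
    unfolding normalized_def using f pos g by (subst integrable_real_density) auto
  also have "(\<lambda>x. f x / ?c * g x) = (\<lambda>x. inverse ?c * (g x * f x))"
    by (simp add: divide_inverse ac_simps)
  finally show "integrable (normalized f) g \<longleftrightarrow> integrable lborel (\<lambda>x. g x * f x)"
    using pos by (simp only: integrable_mult_right_iff) simp
  have "(\<integral>x. g x \<partial>normalized f) = (\<integral>x. f x / ?c * g x \<partial>lborel)"
    unfolding normalized_def using f pos g by (subst integral_real_density) auto
  also have "(\<lambda>x. f x / ?c * g x) = (\<lambda>x. (g x * f x) / ?c)" by (simp add: ac_simps)
  finally show "(\<integral>x. g x \<partial>normalized f) = (\<integral>x. g x * f x \<partial>lborel) / ?c" by simp
qed

text \<open>The parameter is the precision rather than the covariance, because tilting and division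
  by a likelihood act on precisions by subtraction. The mass \<open>a\<close> is left free.\<close>

definition gauss_weight :: "real \<Rightarrow> real^'n^'n \<Rightarrow> real^'n \<Rightarrow> real^'n \<Rightarrow> real" where
  "gauss_weight a J m x = a * quad_weight J (x - m)"

lemma gauss_weight_pos: "0 < a \<Longrightarrow> 0 < gauss_weight a J m x"
  by (simp add: gauss_weight_def quad_weight_pos)

lemma borel_measurable_gauss_weight [measurable]: "gauss_weight a J m \<in> borel_measurable borel"
  unfolding gauss_weight_def by measurable

lemma unnormalized_gaussian_gauss_weight:
  assumes "unnormalized_gaussian f"
  obtains a S m where "0 < a" "pos_def S" "f = gauss_weight a (matrix_inv S) m"
proof -
  obtain c m S where f: "0 < c" "pos_def S" "f = (\<lambda>x. c * mvn_density m S x)"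
    using assms by (auto simp: unnormalized_gaussian_def)
  have "0 < sqrt ((2 * pi) ^ CARD('a) * det S)" using pos_def_det_pos[OF f(2)] by simp
  with f show thesis
    by (intro that[of "c / sqrt ((2 * pi) ^ CARD('a) * det S)" S m])
      (auto simp: gauss_weight_def quad_weight_def mvn_density_def)
qed

lemma gauss_weight_integral_translate:
  assumes "g \<in> borel_measurable borel"
  shows "(\<integral>x. g (x - m) * gauss_weight a J m x \<partial>lborel) = a * (\<integral>x. g x * quad_weight J x \<partial>lborel)"
proof -
  have "(\<integral>x. g (x - m) * gauss_weight a J m x \<partial>lborel) = (\<integral>x. a * (g x * quad_weight J x) \<partial>lborel)"
    using lborel_integral_translate[of "\<lambda>x. a * (g x * quad_weight J x)" "- m"] assms
    by (simp add: gauss_weight_def ac_simps)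
  then show ?thesis by simp
qed

lemma gauss_weight_integrable_translate:
  assumes "g \<in> borel_measurable borel" "integrable lborel (\<lambda>x. g x * quad_weight J x)"
  shows "integrable lborel (\<lambda>x. g (x - m) * gauss_weight a J m x)"
proof -
  have "integrable lborel (\<lambda>x. a * (g x * quad_weight J x))" using assms by simp
  then have "integrable lborel (\<lambda>x. a * (g (x - m) * quad_weight J (x - m)))"
    using lborel_integrable_translate[of "\<lambda>x. a * (g x * quad_weight J x)" "- m"] assms by simp
  then show ?thesis by (simp add: gauss_weight_def ac_simps)
qed

lemma gauss_weight_integrable:
  assumes "pos_def J"
  shows "integrable lborel (gauss_weight a J m)"
  using gauss_weight_integrable_translate[of "\<lambda>_. 1" J m a] quad_weight_integrable(1)[OF assms] by simp

lemma gauss_weight_integral_pos: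
  "pos_def J \<Longrightarrow> 0 < a \<Longrightarrow> 0 < (\<integral>x. gauss_weight a J m x \<partial>lborel)"
  by (intro lborel_integral_pos gauss_weight_integrable gauss_weight_pos)

lemma vec_nth_measurable [measurable]: "(\<lambda>x::real^'n. x $ i) \<in> borel_measurable borel"
  by (intro borel_measurable_continuous_onI continuous_intros)

lemma normalized_gauss_weight:
  fixes J :: "real^'n^'n" and m :: "real^'n"
  assumes J: "pos_def J" and a: "0 < a"
  defines "N \<equiv> normalized (gauss_weight a J m)"
  shows prob_space_normalized_gauss: "prob_space N"
    and square_integrable_normalized_gauss: "square_integrable N (\<lambda>x. x)"
    and mean_normalized_gauss: "(\<integral>x. x \<partial>N) = m"
    and second_moment_normalized_gauss: "second_moment N (\<lambda>x. x - m) (\<lambda>x. x - m) = matrix_inv J"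
    and covariance_normalized_gauss: "covariance N (\<lambda>x. x) = matrix_inv J"
proof -
  let ?f = "gauss_weight a J m"
  note pos = gauss_weight_integral_pos[OF J a, of m]
  note nonneg = less_imp_le[OF gauss_weight_pos[OF a, of J m]]
  note norm_int = normalized_integral[OF borel_measurable_gauss_weight nonneg pos, folded N_def]
  show prob: "prob_space N"
    unfolding N_def by (rule prob_space_normalized[OF gauss_weight_integrable[OF J] nonneg pos])
  interpret N: prob_space N by (rule prob)
  have ax: "x $ i = axis i 1 \<bullet> x" for i and x :: "real^'n" by (simp add: inner_axis')
  have centered: "square_integrable N (\<lambda>x. x - m)"
  proof -
    have "integrable N (\<lambda>x. ((x - m) $ i)\<^sup>2)" for i
      using gauss_weight_integrable_translate[of "\<lambda>x. (x $ i)\<^sup>2" J m a]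
        quad_weight_integrable(3)[OF J, of "axis i 1" "axis i 1"]
      by (subst norm_int) (simp_all add: power2_eq_square inner_axis')
    moreover have "(\<lambda>x. x - m) \<in> borel_measurable N" by (simp add: N_def)
    ultimately show ?thesis by (simp add: square_integrable_def)
  qed
  from N.square_integrable_diff_const[OF this, of "- m"] show si: "square_integrable N (\<lambda>x. x)" by simp
  have "(\<integral>x. x - m \<partial>N) $ i = 0" for i
  proof -
    have "(\<integral>x. x - m \<partial>N) $ i = (\<integral>x. (x - m) $ i \<partial>N)"
      by (rule integral_vec_nth[OF N.square_integrable_integrable[OF centered]])
    also have "\<dots> = 0"
      using gauss_weight_integral_translate[of "\<lambda>x. x $ i" m a J] quad_weight_first_moment[of "axis i 1" J]
      by (subst norm_int) (simp_all add: inner_axis')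
    finally show ?thesis .
  qed
  then have "(\<integral>x. x - m \<partial>N) = 0" by (simp add: vec_eq_iff)
  then show mean: "(\<integral>x. x \<partial>N) = m"
    using N.square_integrable_integrable[OF si] by (simp add: N.prob_space)
  have "(\<integral>x. (x - m) $ i * (x - m) $ j \<partial>N) = matrix_inv J $ i $ j" for i j
  proof -
    \<comment> \<open>Chosen so that \<open>J\<close> maps it to the \<open>j\<close>-th basis
      vector: Stein's identity then has \<open>x $ i * x $ j\<close> on the left and the entry of
      \<open>matrix_inv J\<close> on the right.\<close>
    let ?u = "matrix_inv J *v axis j 1"
    have Ju: "J *v ?u = axis j 1" by (rule matrix_inv_vec[OF pos_def_invertible[OF J]])
    have "(\<integral>x. (x - m) $ i * (x - m) $ j \<partial>N) = (\<integral>x. (x - m) $ i * (x - m) $ j * ?f x \<partial>lborel) / (\<integral>x. ?f x \<partial>lborel)"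
      by (rule norm_int) simp
    also have "(\<integral>x. (x - m) $ i * (x - m) $ j * ?f x \<partial>lborel)
        = a * (\<integral>x. x $ i * x $ j * quad_weight J x \<partial>lborel)"
      by (rule gauss_weight_integral_translate) simp
    also have "(\<integral>x. x $ i * x $ j * quad_weight J x \<partial>lborel)
        = (axis i 1 \<bullet> ?u) * (\<integral>x. quad_weight J x \<partial>lborel)"
      using quad_weight_stein[OF J, of "axis i 1" ?u] unfolding Ju by (simp add: inner_axis')
    also have "axis i 1 \<bullet> ?u = matrix_inv J $ i $ j"
      by (simp add: inner_axis' matrix_vector_mult_basis column_def)
    also have "(\<integral>x. ?f x \<partial>lborel) = a * (\<integral>x. quad_weight J x \<partial>lborel)"
      using gauss_weight_integral_translate[of "\<lambda>_. 1" m a J] by simp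
    finally show ?thesis
      using gauss_weight_integral_pos[OF J, of 1 0] a by (simp add: gauss_weight_def)
  qed
  then show sm: "second_moment N (\<lambda>x. x - m) (\<lambda>x. x - m) = matrix_inv J"
    by (simp add: second_moment_def vec_eq_iff)
  show "covariance N (\<lambda>x. x) = matrix_inv J"
    by (simp add: covariance_def mean sm)
qed

section \<open>Minimizers of the exponential cost\<close>

lemma exp_half_diff_square:
  "(exp (a / 2) - exp (b / 2))\<^sup>2 = exp a + exp b - 2 * exp ((a + b) / 2)" for a b :: real
proof -
  have "(exp (c / 2))\<^sup>2 = exp c" for c :: real by (simp add: exp_double[symmetric])
  moreover have "exp (a / 2) * exp (b / 2) = exp ((a + b) / 2)"
    by (simp add: exp_add[symmetric] add_divide_distrib)
  ultimately show ?thesis by (simp only: power2_diff mult.assoc)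
qed

lemma exp_add_ge: "2 * exp ((a + b) / 2) \<le> exp a + exp (b::real)"
proof -
  have "0 \<le> (exp (a / 2) - exp (b / 2))\<^sup>2" by simp
  also have "\<dots> = exp a + exp b - 2 * exp ((a + b) / 2)"
    by (rule exp_half_diff_square)
  finally show ?thesis by simp
qed

text \<open>The cost is invariant under the reflection of b in the centre m. By the parallelogram law the average
  of the two integrands exceeds the integrand for m by the factor exp (mu |b - m|^2).\<close>
lemma risk_cost_minimizer:
  fixes J :: "real^'n^'n"
  assumes a: "0 < a" and \<mu>: "0 < \<mu>" and min: "is_minimizer (risk_cost \<mu> (gauss_weight a J m)) b"
  shows "b = m"
proof (rule ccontr)
  assume "b \<noteq> m"
  let ?f = "gauss_weight a J m" and ?b = "2 *\<^sub>R m - b" and ?C = "risk_cost \<mu> (gauss_weight a J m)"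
  let ?i = "\<lambda>c x. exp (\<mu> * ((x - c) \<bullet> (x - c))) * ?f x"
  define \<kappa> where "\<kappa> = exp (\<mu> * ((m - b) \<bullet> (m - b)))"
  have "0 < (m - b) \<bullet> (m - b)" using \<open>b \<noteq> m\<close> by simp
  then have \<kappa>: "1 < \<kappa>" using \<mu> by (simp add: \<kappa>_def)
  have meas [measurable]: "?i c \<in> borel_measurable borel" for c
    by (intro borel_measurable_times borel_measurable_gauss_weight
        borel_measurable_continuous_onI continuous_intros)
  have pos: "0 < ?i c x" for c x by (simp add: gauss_weight_pos a)
  have reflect: "?C ?b = ?C b"
  proof -
    have "?i ?b (2 *\<^sub>R m - x) = ?i b x" for x
    proof -
      have "2 *\<^sub>R m - x - ?b = - (x - b)" "2 *\<^sub>R m - x - m = - (x - m)"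
        by (simp_all add: scaleR_2)
      then show ?thesis
        by (simp only: gauss_weight_def quad_weight_minus inner_minus_left inner_minus_right minus_minus)
    qed
    then show ?thesis
      using lborel_nn_integral_reflect[of "\<lambda>x. ennreal (?i ?b x)" "2 *\<^sub>R m"]
      by (simp add: risk_cost_def)
  qed
  have convex: "2 * \<kappa> * ?i m x \<le> ?i b x + ?i ?b x" for x
  proof -
    have b1: "x - b = (x - m) + (m - b)" and b2: "x - ?b = (x - m) - (m - b)"
      by (simp_all add: scaleR_2)
    have parallelogram: "(y + v) \<bullet> (y + v) + (y - v) \<bullet> (y - v) = 2 * (v \<bullet> v + y \<bullet> y)" for y v :: "real^'n"
      by (simp add: inner_add_left inner_add_right inner_diff_left inner_diff_right)
    have eq: "(\<mu> * ((x - b) \<bullet> (x - b)) + \<mu> * ((x - ?b) \<bullet> (x - ?b))) / 2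
        = \<mu> * ((m - b) \<bullet> (m - b)) + \<mu> * ((x - m) \<bullet> (x - m))"
      unfolding b1 b2 distrib_left[symmetric] parallelogram by simp
    have "2 * exp (\<mu> * ((m - b) \<bullet> (m - b)) + \<mu> * ((x - m) \<bullet> (x - m)))
        \<le> exp (\<mu> * ((x - b) \<bullet> (x - b))) + exp (\<mu> * ((x - ?b) \<bullet> (x - ?b)))"
      unfolding eq[symmetric] by (rule exp_add_ge)
    from mult_right_mono[OF this less_imp_le[OF gauss_weight_pos[OF a, of J m x]]] show ?thesis
      by (simp only: \<kappa>_def exp_add distrib_right mult.assoc)
  qed
  have "ennreal (2 * \<kappa>) * ?C m = (\<integral>\<^sup>+x. ennreal (2 * \<kappa> * ?i m x) \<partial>lborel)"
    using \<kappa> pos by (simp add: risk_cost_def nn_integral_cmult[symmetric] ennreal_mult less_imp_le mult.assoc)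
  also have "\<dots> \<le> (\<integral>\<^sup>+x. ennreal (?i b x) + ennreal (?i ?b x) \<partial>lborel)"
    using convex pos by (intro nn_integral_mono) (simp add: ennreal_plus[symmetric] less_imp_le ennreal_leI del: ennreal_plus)
  also have "\<dots> = ?C b + ?C ?b" unfolding risk_cost_def by (rule nn_integral_add) auto
  also have "\<dots> = 2 * ?C b" by (simp only: reflect mult_2)
  finally have "ennreal (2 * \<kappa>) * ?C b \<le> 2 * ?C b"
    using min by (meson is_minimizer_def mult_left_mono order_trans zero_le)
  \<comment> \<open>The inequality between \<open>\<kappa>\<close> times the cost and the cost is
    contradictory only for a value strictly between 0 and infinity. Finiteness is part of
    \<open>is_minimizer\<close>; positivity holds because the integrand is positive
    everywhere.\<close>
  moreover have fin: "?C b < \<infinity>" using min by (simp add: is_minimizer_def)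
  moreover have "?C b \<noteq> 0"
  proof
    assume "?C b = 0"
    then have "AE x in lborel. ennreal (?i b x) = 0"
      unfolding risk_cost_def by (subst (asm) nn_integral_0_iff_AE) auto
    then have "AE x in (lborel :: (real^'n) measure). False"
      by eventually_elim (metis pos ennreal_eq_0_iff not_le)
    then show False using AE_lborel_False by blast
  qed
  ultimately show False
  proof (cases "?C b")
    case (real r)
    then have "2 * \<kappa> * r \<le> 2 * r" "0 < r"
      using \<open>ennreal (2 * \<kappa>) * ?C b \<le> 2 * ?C b\<close> \<open>?C b \<noteq> 0\<close> \<kappa>
      by (auto simp: ennreal_mult[symmetric] ennreal_numeral[symmetric] simp del: ennreal_numeral)
    then show False using \<kappa> by simp
  qed simp
qed

section \<open>Exponential tilting and recognition of Gaussian weights\<close>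

lemma mat_vector_mult: "mat c *v x = c *\<^sub>R (x :: real^'n)"
  by (simp add: matrix_scaleR[symmetric])

text \<open>The 2 compensates the \<open>1/2\<close> in the exponent. As the tilt is centred at
  \<open>m\<close> itself, no linear term arises and the centre is preserved; this is why the risk
  parameter enters the predicted covariance but not the formula for the predicted mean.\<close>

lemma gauss_weight_tilt:
  "exp (\<mu> * ((x - m) \<bullet> (x - m))) * gauss_weight a J m x = gauss_weight a (J - mat (2 * \<mu>)) m x"
proof -
  have "exp (\<mu> * (z \<bullet> z)) * quad_weight J z = quad_weight (J - mat (2 * \<mu>)) z" for z
    unfolding quad_weight_def exp_add[symmetric] matrix_vector_mult_diff_rdistrib mat_vector_mult
    by (simp add: inner_diff_right algebra_simps)
  from this[of "x - m"] show ?thesis by (simp add: gauss_weight_def ac_simps)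
qed

text \<open>With \<open>t = 2 * \<mu>\<close> and \<open>q = matrix_inv P *v y\<close>,
  nonnegativity of the form of \<open>P\<close> at \<open>q - t *\<^sub>R y\<close> bounds
  \<open>y \<bullet> q\<close> below by
  \<open>2 * t * (y \<bullet> y) - t * t * (y \<bullet> (P *v y))\<close>. The smallness of
  \<open>\<mu>\<close> makes this exceed \<open>t * (y \<bullet> y)\<close> when \<open>t\<close> is
  positive; the case 0 is treated apart.\<close>

lemma pos_def_tilt:
  fixes P :: "real^'n^'n"
  assumes P: "pos_def P" and \<mu>: "0 \<le> \<mu>" and small: "pos_def (mat 1 - (2 * \<mu>) *\<^sub>R P)"
  shows "pos_def (matrix_inv P - mat (2 * \<mu>))"
proof -
  note inv = pos_def_invertible[OF P]
  have "transpose (matrix_inv P - mat (2 * \<mu>)) = matrix_inv P - mat (2 * \<mu>)"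
    using pos_def_symmetric[OF pos_def_matrix_inv[OF P]] by (simp add: transpose_diff transpose_mat)
  moreover have "0 < y \<bullet> ((matrix_inv P - mat (2 * \<mu>)) *v y)" if "y \<noteq> 0" for y
  proof (cases "\<mu> = 0")
    case True
    then show ?thesis using pos_def_matrix_inv[OF P] that
      by (simp add: matrix_vector_mult_diff_rdistrib mat_vector_mult pos_def_def)
  next
    case False
    let ?q = "matrix_inv P *v y" and ?t = "2 * \<mu>"
    have "0 \<le> z \<bullet> (P *v z)" for z using P by (cases "z = 0") (auto simp: pos_def_def less_imp_le)
    then have "0 \<le> (?q - ?t *\<^sub>R y) \<bullet> (P *v (?q - ?t *\<^sub>R y))" .
    also have "\<dots> = y \<bullet> ?q - 2 * ?t * (y \<bullet> y) + ?t * (?t * (y \<bullet> (P *v y)))"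
      using symmetric_inner_commute[OF pos_def_symmetric[OF P], of ?q y]
      by (simp add: matrix_vector_mult_diff_distrib matrix_vector_mult_scaleR matrix_inv_vec[OF inv]
          inner_diff_left inner_diff_right inner_commute[of ?q y] right_diff_distrib)
    finally have 1: "0 \<le> y \<bullet> ?q - 2 * ?t * (y \<bullet> y) + ?t * (?t * (y \<bullet> (P *v y)))" .
    have "0 < y \<bullet> ((mat 1 - (2 * \<mu>) *\<^sub>R P) *v y)" using small that by (simp add: pos_def_def)
    then have "?t * (y \<bullet> (P *v y)) < y \<bullet> y"
      by (simp add: matrix_vector_mult_diff_rdistrib inner_diff_right scaleR_matrix_vector_assoc[symmetric])
    then have "?t * (?t * (y \<bullet> (P *v y))) < ?t * (y \<bullet> y)"
      using \<mu> False by (intro mult_strict_left_mono) auto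
    with 1 show ?thesis
      by (simp add: matrix_vector_mult_diff_rdistrib mat_vector_mult inner_diff_right)
  qed
  ultimately show ?thesis by (simp add: pos_def_def)
qed

text \<open>In a direction u in which the form J is not positive, g (z + u) + g (z - u) is at least
  2 cosh (l z) g z with l affine, so translation invariance of the integral forces l = 0. Then g is invariant
  under translation by u, which contradicts the existence of the first moment along u.\<close>
lemma integrable_exp_quadratic_imp_pos_def:
  fixes J :: "real^'n^'n"
  assumes sym: "transpose J = J" and a: "0 < a"
    and g: "g = (\<lambda>z. a * quad_weight J z * exp (b \<bullet> z))"
    and int: "integrable lborel g" and int1: "\<And>u. integrable lborel (\<lambda>z. (u \<bullet> z) * g z)"
  shows "pos_def J"
proof -
  have meas [measurable]: "g \<in> borel_measurable borel" unfolding g by measurable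
  have pos: "0 < g z" for z by (simp add: g a quad_weight_pos)
  have "0 < u \<bullet> (J *v u)" if u: "u \<noteq> 0" for u
  proof (rule ccontr)
    assume "\<not> 0 < u \<bullet> (J *v u)"
    then have neg: "u \<bullet> (J *v u) \<le> 0" by simp
    define l where "l z = b \<bullet> u - z \<bullet> (J *v u)" for z
    have shift: "g (z + u) = g z * exp (l z) * exp (- (1/2) * (u \<bullet> (J *v u)))" for z
      by (simp add: g quad_weight_translate[OF sym] l_def inner_add_right exp_add[symmetric])
    have shift': "g (z - u) = g z * exp (- l z) * exp (- (1/2) * (u \<bullet> (J *v u)))" for z
      using quad_weight_translate[OF sym, of z "- u"] matrix_vector_mult_scaleR[of J "-1" u]
      by (simp add: g l_def inner_diff_right exp_add[symmetric])
    have ge: "0 \<le> g (z + u) + g (z - u) - 2 * g z" and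
      gt: "l z \<noteq> 0 \<Longrightarrow> 0 < g (z + u) + g (z - u) - 2 * g z" for z
    proof -
      let ?k = "exp (- (1/2) * (u \<bullet> (J *v u)))"
      have k: "1 \<le> ?k" using neg by simp
      \<comment> \<open>The gap between arithmetic and geometric mean is kept as a square, which
        gives strict inequality wherever \<open>l z\<close> is nonzero.\<close>
      have sq: "exp (l z) + exp (- l z) - 2 = (exp (l z / 2) - exp (- l z / 2))\<^sup>2"
        using exp_half_diff_square[of "l z" "- l z"] by simp
      have "g z * (exp (l z) + exp (- l z)) * 1 \<le> g z * (exp (l z) + exp (- l z)) * ?k"
        using k pos[of z] by (intro mult_left_mono) (auto simp: less_imp_le add_nonneg_nonneg)
      also have "\<dots> = g (z + u) + g (z - u)" unfolding shift shift' by (simp add: algebra_simps)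
      finally have *: "g z * (exp (l z / 2) - exp (- l z / 2))\<^sup>2 \<le> g (z + u) + g (z - u) - 2 * g z"
        unfolding sq[symmetric] by (simp add: algebra_simps)
      have "0 \<le> g z * (exp (l z / 2) - exp (- l z / 2))\<^sup>2" using pos[of z] by simp
      with * show "0 \<le> g (z + u) + g (z - u) - 2 * g z" by linarith
      assume "l z \<noteq> 0"
      then have "0 < g z * (exp (l z / 2) - exp (- l z / 2))\<^sup>2" using pos[of z] by simp
      with * show "0 < g (z + u) + g (z - u) - 2 * g z" by linarith
    qed
    have i1: "integrable lborel (\<lambda>z. g (z + u))" "integrable lborel (\<lambda>z. g (z - u))"
      using int lborel_integrable_translate[OF meas, of u] lborel_integrable_translate[OF meas, of "- u"]
      by simp_all
    then have i: "integrable lborel (\<lambda>z. g (z + u) + g (z - u) - 2 * g z)" using int by simp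
    have "(\<integral>z. g (z + u) + g (z - u) - 2 * g z \<partial>lborel) = 0"
      using i1 int lborel_integral_translate[OF meas, of u] lborel_integral_translate[OF meas, of "- u"]
      by simp
    then have "AE z in lborel. g (z + u) + g (z - u) - 2 * g z = 0"
      using integral_nonneg_eq_0_iff_AE[OF i] ge by simp
    then have ae: "AE z in lborel. l z = 0"
      by eventually_elim (use gt in force)
    have "l z = 0" for z
    proof (rule ccontr)
      assume "l z \<noteq> 0"
      have cont: "continuous_on UNIV l" unfolding l_def by (intro continuous_intros)
      have op: "open {z. l z \<noteq> 0}"
        using open_Collect_neq[OF cont continuous_on_const] by simp
      from ae have "{z. l z \<noteq> 0} \<in> null_sets lborel"
        using op AE_iff_null[of lborel "\<lambda>z. l z = 0"] by simp
      then have "negligible {z. l z \<noteq> 0}"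
        by (simp add: negligible_iff_null_sets null_sets_completionI)
      with op have "{z. l z \<noteq> 0} = {}" using open_not_negligible by blast
      with \<open>l z \<noteq> 0\<close> show False by auto
    qed
    then have l0: "l z = 0" for z .
    \<comment> \<open>At 0 the affine function equals \<open>b \<bullet> u\<close>, so this
      vanishes, and its value at \<open>u\<close> then forces the quadratic term to vanish. The
      factor independent of \<open>z\<close> in \<open>shift\<close> is therefore 1.\<close>
    from l0[of 0] l0[of u] have "u \<bullet> (J *v u) = 0" by (simp add: l_def)
    then have inv: "g (z + u) = g z" for z by (simp add: shift l0)
    have "(\<integral>z. (u \<bullet> z) * g z \<partial>lborel) = (\<integral>z. (u \<bullet> (z + u)) * g (z + u) \<partial>lborel)"
      by (rule lborel_integral_translate[symmetric]) measurable
    also have "\<dots> = (\<integral>z. (u \<bullet> z) * g z \<partial>lborel) + (u \<bullet> u) * (\<integral>z. g z \<partial>lborel)"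
      using int int1[of u] by (simp add: inv inner_add_right distrib_right)
    finally have "(u \<bullet> u) * (\<integral>z. g z \<partial>lborel) = 0" by simp
    with u lborel_integral_pos[OF int pos] show False by simp
  qed
  with sym show ?thesis by (simp add: pos_def_def)
qed

lemma complete_square:
  assumes J: "pos_def J"
  shows "\<exists>k>0. (\<lambda>z. quad_weight J z * exp (b \<bullet> z)) = gauss_weight k J (matrix_inv J *v b)"
proof (intro exI conjI ext)
  let ?m = "matrix_inv J *v b"
  have Jm: "J *v ?m = b" by (rule matrix_inv_vec[OF pos_def_invertible[OF J]])
  show "0 < exp ((1/2) * (?m \<bullet> b))" by simp
  fix z
  have "(z - ?m) \<bullet> (J *v (z - ?m)) = z \<bullet> (J *v z) - 2 * (b \<bullet> z) + ?m \<bullet> b"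
    using symmetric_inner_commute[OF pos_def_symmetric[OF J], of ?m z]
    by (simp add: matrix_vector_mult_diff_distrib inner_diff_left inner_diff_right Jm inner_commute[of z b])
  then show "quad_weight J z * exp (b \<bullet> z) = gauss_weight (exp ((1/2) * (?m \<bullet> b))) J ?m z"
    unfolding gauss_weight_def quad_weight_def by (simp add: exp_add[symmetric] algebra_simps)
qed

section \<open>Prediction and correction\<close>

text \<open>The section at \<open>x\<close> of the preimage of \<open>T\<close> under the sum map
  has the probability that the kernel at \<open>x\<close> gives to \<open>T\<close>, so integrating
  sections gives the law without any density of the kernel. The choice \<open>T = UNIV\<close> shows
  that \<open>g\<close> has the same mass as \<open>f\<close>, and both normalizations divide by the
  same constant.\<close>

lemma normalized_predicts:
  fixes A :: "real^'n^'n" and W :: "'a \<Rightarrow> real^'n"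
  assumes M: "prob_space M" and W: "W \<in> borel_measurable M"
    and f: "integrable lborel f" "\<And>x. 0 \<le> f x" "0 < (\<integral>x. f x \<partial>lborel)"
    and pred: "predicts (\<lambda>x'. distr M borel (\<lambda>\<alpha>. A *v x' + W \<alpha>)) f g"
  shows "integrable lborel g" and "0 < (\<integral>x. g x \<partial>lborel)"
    and "normalized g = distr (normalized f \<Otimes>\<^sub>M M) borel (\<lambda>s. A *v fst s + W (snd s))"
proof -
  interpret M: prob_space M by (rule M)
  let ?c = "\<integral>x. f x \<partial>lborel" and ?h = "\<lambda>s. A *v fst s + W (snd s)"
  let ?K = "\<lambda>x'. distr M borel (\<lambda>\<alpha>. A *v x' + W \<alpha>)"
  note [measurable] = W
  have f_meas [measurable]: "f \<in> borel_measurable borel" using f(1) by (auto dest: borel_measurable_integrable)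
  have Af: "(\<lambda>s. A *v fst s) \<in> borel_measurable (borel \<Otimes>\<^sub>M M)"
    by (intro borel_measurable_matrix_vector measurable_fst)
  have h [measurable]: "?h \<in> borel_measurable (borel \<Otimes>\<^sub>M M)"
    by (intro borel_measurable_add Af measurable_compose[OF measurable_snd W])
  have g: "g \<in> borel_measurable borel" "\<And>x. 0 \<le> g x" using pred by (auto simp: predicts_def)
  have K: "(\<lambda>x. emeasure (?K x) T) \<in> borel_measurable borel"
    and pair: "emeasure (distr (normalized f \<Otimes>\<^sub>M M) borel ?h) T
      = (\<integral>\<^sup>+x. ennreal (g x) * indicator T x \<partial>lborel) / ennreal ?c" if T: "T \<in> sets borel" for T
  proof -
    let ?B = "?h -` T \<inter> space (borel \<Otimes>\<^sub>M M)"
    have B: "?B \<in> sets (borel \<Otimes>\<^sub>M M)" using h T by (rule measurable_sets)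
    have sec: "emeasure (?K x) T = emeasure M (Pair x -` ?B)" for x
    proof -
      have "(\<lambda>\<alpha>. A *v x + W \<alpha>) \<in> borel_measurable M" by (intro borel_measurable_add) auto
      then have "emeasure (?K x) T = emeasure M ((\<lambda>\<alpha>. A *v x + W \<alpha>) -` T \<inter> space M)"
        using T by (simp add: emeasure_distr)
      also have "(\<lambda>\<alpha>. A *v x + W \<alpha>) -` T \<inter> space M = Pair x -` ?B"
        by (auto simp: space_pair_measure)
      finally show ?thesis .
    qed
    show K: "(\<lambda>x. emeasure (?K x) T) \<in> borel_measurable borel"
      unfolding sec using B by (rule M.measurable_emeasure_Pair)
    have "emeasure (distr (normalized f \<Otimes>\<^sub>M M) borel ?h) T
        = emeasure (normalized f \<Otimes>\<^sub>M M) ?B"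
      using T by (subst emeasure_distr) (simp_all add: space_pair_measure cong: measurable_cong_sets)
    also have "\<dots> = (\<integral>\<^sup>+x. emeasure (?K x) T \<partial>normalized f)"
      unfolding sec using B by (intro M.emeasure_pair_measure_alt) (simp cong: sets_pair_measure_cong)
    also have "\<dots> = (\<integral>\<^sup>+x. ennreal (f x / ?c) * emeasure (?K x) T \<partial>lborel)"
      unfolding normalized_def using K by (intro nn_integral_density) auto
    also have "\<dots> = (\<integral>\<^sup>+x. emeasure (?K x) T * ennreal (f x) / ennreal ?c \<partial>lborel)"
      using f by (intro nn_integral_cong) (simp add: divide_ennreal[symmetric] ennreal_divide_times ennreal_times_divide mult.commute)
    also have "\<dots> = (\<integral>\<^sup>+x. emeasure (?K x) T * ennreal (f x) \<partial>lborel) / ennreal ?c"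
      using K by (intro nn_integral_divide) auto
    also have "(\<integral>\<^sup>+x. emeasure (?K x) T * ennreal (f x) \<partial>lborel) = (\<integral>\<^sup>+x. ennreal (g x) * indicator T x \<partial>lborel)"
      using pred T by (simp add: predicts_def)
    finally show "emeasure (distr (normalized f \<Otimes>\<^sub>M M) borel ?h) T
      = (\<integral>\<^sup>+x. ennreal (g x) * indicator T x \<partial>lborel) / ennreal ?c" .
  qed
  interpret N: prob_space "normalized f" by (rule prob_space_normalized[OF f])
  interpret NM: pair_prob_space "normalized f" M ..
  have "prob_space (distr (normalized f \<Otimes>\<^sub>M M) borel ?h)"
    by (intro NM.prob_space_distr) simp
  then have "emeasure (distr (normalized f \<Otimes>\<^sub>M M) borel ?h) UNIV = 1"
    using prob_space.emeasure_space_1 by fastforce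
  then have "(\<integral>\<^sup>+x. ennreal (g x) \<partial>lborel) / ennreal ?c * ennreal ?c = ennreal ?c"
    using pair[of UNIV] by simp
  then have mass: "(\<integral>\<^sup>+x. ennreal (g x) \<partial>lborel) = ennreal ?c"
    using f(3) by (simp add: ennreal_divide_times ennreal_divide_self)
  then show int: "integrable lborel g"
    using g by (intro integrableI_nonneg) auto
  have mass': "(\<integral>x. g x \<partial>lborel) = ?c"
    using mass g f(3) by (simp add: integral_eq_nn_integral)
  with f show pos: "0 < (\<integral>x. g x \<partial>lborel)" by simp
  show "normalized g = distr (normalized f \<Otimes>\<^sub>M M) borel ?h"
    using emeasure_normalized[OF g pos] pair mass' by (intro measure_eqI) auto
qed

lemma predicted_moments:
  fixes A :: "real^'n^'n" and W :: "'a \<Rightarrow> real^'n"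
  assumes M: "prob_space M" and N: "prob_space N" "sets N = sets borel"
    and X: "square_integrable N (\<lambda>x. x)" "(\<integral>x. x \<partial>N) = m"
    and W: "square_integrable M W" "(\<integral>\<alpha>. W \<alpha> \<partial>M) = 0"
    and L: "L = distr (N \<Otimes>\<^sub>M M) borel (\<lambda>s. A *v fst s + W (snd s))"
  shows "square_integrable L (\<lambda>z. z)" and "(\<integral>z. z \<partial>L) = A *v m"
    and "second_moment L (\<lambda>z. z - A *v m) (\<lambda>z. z - A *v m)
      = A ** second_moment N (\<lambda>x. x - m) (\<lambda>x. x - m) ** transpose A + second_moment M W W"
proof -
  interpret M: prob_space M by (rule M)
  interpret N: prob_space N by (rule N)
  interpret NM: pair_prob_space N M ..
  let ?h = "\<lambda>s. A *v fst s + W (snd s)"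
  note h = NM.second_moment_linear_plus_noise[OF X(1) W, of A]
  note h_meas = square_integrable_measurable[OF h(1)]
  show L_si: "square_integrable L (\<lambda>z. z)"
    unfolding L using h(1) by (subst square_integrable_distr[OF h_meas]) auto
  have AX: "integrable (N \<Otimes>\<^sub>M M) (\<lambda>s. A *v fst s)" and Wi: "integrable (N \<Otimes>\<^sub>M M) (\<lambda>s. W (snd s))"
    and Xi: "integrable (N \<Otimes>\<^sub>M M) fst"
    using NM.square_integrable_integrable[OF square_integrable_matrix_vector[OF NM.square_integrable_fst[OF X(1)], of A]]
      NM.square_integrable_integrable[OF NM.square_integrable_snd[OF W(1)]]
      NM.square_integrable_integrable[OF NM.square_integrable_fst[OF X(1)]] by simp_all
  have "(\<integral>z. z \<partial>L) = (\<integral>s. ?h s \<partial>(N \<Otimes>\<^sub>M M))"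
    unfolding L by (rule integral_distr[OF h_meas]) simp
  also have "\<dots> = (\<integral>s. A *v fst s \<partial>(N \<Otimes>\<^sub>M M)) + (\<integral>s. W (snd s) \<partial>(N \<Otimes>\<^sub>M M))"
    by (rule Bochner_Integration.integral_add[OF AX Wi])
  also have "(\<integral>s. W (snd s) \<partial>(N \<Otimes>\<^sub>M M)) = 0"
    using NM.integral_snd_comp[OF square_integrable_measurable[OF W(1)]] W(2) by simp
  also have "(\<integral>s. A *v fst s \<partial>(N \<Otimes>\<^sub>M M)) = A *v (\<integral>s. fst s \<partial>(N \<Otimes>\<^sub>M M))"
    by (rule integral_bounded_linear[OF matrix_vector_mul_bounded_linear Xi])
  also have "(\<integral>s. fst s \<partial>(N \<Otimes>\<^sub>M M)) = m"
    using NM.integral_fst_comp[OF square_integrable_measurable[OF X(1)]] X(2) by simp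
  finally show "(\<integral>z. z \<partial>L) = A *v m" by simp
  have center: "?h s - A *v m = A *v (fst s - m) + W (snd s)" for s
    by (simp add: matrix_vector_mult_diff_distrib)
  have "second_moment L (\<lambda>z. z - A *v m) (\<lambda>z. z - A *v m)
      = second_moment (N \<Otimes>\<^sub>M M) (\<lambda>s. ?h s - A *v m) (\<lambda>s. ?h s - A *v m)"
    unfolding L by (rule second_moment_distr[OF h_meas]) auto
  also have "\<dots> = A ** second_moment N (\<lambda>x. x - m) (\<lambda>x. x - m) ** transpose A + second_moment M W W"
    unfolding center
    by (rule NM.second_moment_linear_plus_noise(2)[OF N.square_integrable_diff_const[OF X(1)] W])
  finally show "second_moment L (\<lambda>z. z - A *v m) (\<lambda>z. z - A *v m)
      = A ** second_moment N (\<lambda>x. x - m) (\<lambda>x. x - m) ** transpose A + second_moment M W W" .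
qed

text \<open>Subtracting \<open>H *v a\<close> turns the innovation into \<open>H\<close> applied to
  the prediction error plus an independent noise.\<close>

lemma innovation_moments:
  fixes H :: "real^'n^'p"
  assumes L: "prob_space L" and M: "prob_space M"
    and X: "square_integrable L (\<lambda>z. z)" and V: "square_integrable M V" "(\<integral>\<alpha>. V \<alpha> \<partial>M) = 0"
    and P: "second_moment L (\<lambda>z. z - a) (\<lambda>z. z - a) = P"
    and J: "J = L \<Otimes>\<^sub>M distr M borel V"
    and innov: "\<And>z n. innov (z, n) = (H *v z + n) - H *v a"
  shows "second_moment J innov innov = H ** P ** transpose H + second_moment M V V"
    and "second_moment J (\<lambda>s. fst s - a) innov = P ** transpose H"
proof -
  interpret L: prob_space L by (rule L)
  interpret M: prob_space M by (rule M)
  note V_meas = square_integrable_measurable[OF V(1)]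
  interpret D: prob_space "distr M borel V" by (rule M.prob_space_distr[OF V_meas])
  interpret LD: pair_prob_space L "distr M borel V" ..
  have innov': "innov = (\<lambda>s. H *v (fst s - a) + snd s)"
    using innov[of "fst s" "snd s" for s] by (intro ext) (simp add: matrix_vector_mult_diff_distrib)
  have si: "square_integrable (distr M borel V) (\<lambda>n. n)"
    using V by (subst square_integrable_distr[OF V_meas]) auto
  have mean: "(\<integral>n. n \<partial>distr M borel V) = 0"
    using V(2) by (subst integral_distr[OF V_meas]) auto
  have cov: "second_moment (distr M borel V) (\<lambda>n. n) (\<lambda>n. n) = second_moment M V V"
    by (subst second_moment_distr[OF V_meas]) auto
  note * = LD.second_moment_linear_plus_noise[OF L.square_integrable_diff_const[OF X, of a] si mean, of H]
  show "second_moment J innov innov = H ** P ** transpose H + second_moment M V V"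
    unfolding J innov' *(2) P cov ..
  show "second_moment J (\<lambda>s. fst s - a) innov = P ** transpose H"
    unfolding J innov' *(3) P ..
qed

text \<open>Dividing the posterior by the likelihood leaves an exponential of a quadratic polynomial. Hence the prior g
  is itself Gaussian, whatever the distribution of the process noise, and is determined by its first two
  moments.\<close>
lemma posterior_information:
  fixes H :: "real^'n^'p" and S P :: "real^'n^'n"
  assumes S: "pos_def S" and a: "0 < a"
    and posterior: "\<And>z. gauss_weight a (matrix_inv S) m z = mvn_density (H *v z) R y * g z / c"
    and R: "invertible R \<Longrightarrow> pos_def R"
    and g: "integrable lborel g" "\<And>z. 0 \<le> g z" "0 < (\<integral>z. g z \<partial>lborel)"
    and moments: "square_integrable (normalized g) (\<lambda>z. z)" "(\<integral>z. z \<partial>normalized g) = xp"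
      "second_moment (normalized g) (\<lambda>z. z - xp) (\<lambda>z. z - xp) = P"
  shows "pos_def R"
    and "\<exists>J. pos_def J \<and> P = matrix_inv J \<and> matrix_inv S = J + transpose H ** matrix_inv R ** H \<and>
      matrix_inv S *v m = J *v xp + transpose H *v (matrix_inv R *v y)"
proof -
  let ?\<Phi> = "gauss_weight a (matrix_inv S) m"
  have \<Phi>_pos: "0 < ?\<Phi> z" for z by (rule gauss_weight_pos[OF a])
  \<comment> \<open>For a singular \<open>R\<close> the density divides by 0 and is identically 0,
    whereas the posterior weight is positive. The same convention for division excludes
    \<open>c = 0\<close> below.\<close>
  have "det R \<noteq> 0"
    using posterior[of 0] \<Phi>_pos[of 0] by (auto simp: mvn_density_def)
  then show R_pd: "pos_def R" by (intro R) (simp add: invertible_det_nz)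
  define G where "G = matrix_inv R"
  define D where "D = matrix_inv S"
  define r where "r = sqrt ((2 * pi) ^ CARD('p) * det R)"
  have G_sym: "transpose G = G" unfolding G_def by (intro pos_def_symmetric pos_def_matrix_inv R_pd)
  have D_sym: "transpose D = D" unfolding D_def by (intro pos_def_symmetric pos_def_matrix_inv S)
  have r: "r \<noteq> 0" using \<open>det R \<noteq> 0\<close> by (simp add: r_def)
  have c: "c \<noteq> 0" using posterior[of 0] \<Phi>_pos[of 0] by auto
  \<comment> \<open>\<open>J\<close> and \<open>b\<close> are the quadratic and linear coefficients
    in the exponent of posterior over likelihood, and \<open>C\<close> collects the constants. As a
    difference of precisions, \<open>J\<close> is so far only symmetric.\<close>
  define J where "J = D - transpose H ** G ** H"
  define b where "b = D *v m - transpose H *v (G *v y)"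
  define C where "C = a * c * r * exp (- (1/2) * (m \<bullet> (D *v m)) + (1/2) * (y \<bullet> (G *v y)))"
  have J_sym: "transpose J = J"
    by (simp add: J_def transpose_diff matrix_transpose_mul D_sym G_sym matrix_mul_assoc)
  have g_eq: "g z = C * quad_weight J z * exp (b \<bullet> z)" for z
  proof -
    let ?q = "(y - H *v z) \<bullet> (G *v (y - H *v z))"
    have "?\<Phi> z = exp (- (1/2) * ?q) / r * g z / c"
      using posterior[of z] by (simp add: mvn_density_def G_def r_def)
    then have "g z = ?\<Phi> z * c * r * exp ((1/2) * ?q)"
      using r c by (simp add: exp_minus field_simps)
    also have "\<dots> = a * c * r * exp (- (1/2) * ((z - m) \<bullet> (D *v (z - m))) + (1/2) * ?q)"
      unfolding gauss_weight_def quad_weight_def exp_add D_def by (simp add: ac_simps)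
    also have "- (1/2) * ((z - m) \<bullet> (D *v (z - m))) + (1/2) * ?q
        = (- (1/2) * (m \<bullet> (D *v m)) + (1/2) * (y \<bullet> (G *v y))) + (- (1/2) * (z \<bullet> (J *v z)) + b \<bullet> z)"
    proof -
      have 1: "z \<bullet> (J *v z) = z \<bullet> (D *v z) - (H *v z) \<bullet> (G *v (H *v z))"
        using inner_matrix_vector[of "z" "transpose H" "G *v (H *v z)"]
        by (simp add: J_def matrix_vector_mult_diff_rdistrib inner_diff_right
            matrix_vector_mul_assoc[symmetric] del: transpose_matrix_vector)
      have 2: "b \<bullet> z = m \<bullet> (D *v z) - (H *v z) \<bullet> (G *v y)"
        using inner_matrix_vector[of "z" "transpose H" "G *v y"] symmetric_inner_commute[OF D_sym, of m z]
        by (simp add: b_def inner_diff_right inner_commute[of _ z] del: transpose_matrix_vector)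
      show ?thesis
        unfolding 1 2
        using symmetric_inner_commute[OF D_sym, of m z] symmetric_inner_commute[OF G_sym, of "H *v z" y]
        by (simp add: matrix_vector_mult_diff_distrib inner_diff_left inner_diff_right field_simps)
    qed
    finally show ?thesis unfolding C_def quad_weight_def exp_add by (simp only: mult.assoc)
  qed
  have "C \<noteq> 0" using a c r by (simp add: C_def)
  \<comment> \<open>The sign of \<open>C\<close> is read off from \<open>g 0 = C\<close>, so the
    sign of \<open>c\<close> need not be known separately.\<close>
  moreover have "0 \<le> C" using g(2)[of 0] by (simp add: g_eq quad_weight_def)
  ultimately have C: "0 < C" by simp
  have g_meas: "g \<in> borel_measurable borel" using g(1) by (auto dest: borel_measurable_integrable)
  interpret N: prob_space "normalized g" by (rule prob_space_normalized[OF g])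
  have int1: "integrable lborel (\<lambda>z. (u \<bullet> z) * g z)" for u
  proof -
    have "integrable (normalized g) (\<lambda>z. u \<bullet> z)"
      using N.square_integrable_integrable[OF moments(1)] by simp
    then show ?thesis
      by (subst (asm) normalized_integral(1)[OF g_meas g(2,3)]) auto
  qed
  have J: "pos_def J"
    by (rule integrable_exp_quadratic_imp_pos_def[OF J_sym C ext[OF g_eq] g(1) int1])
  obtain k where k: "0 < k" "(\<lambda>z. quad_weight J z * exp (b \<bullet> z)) = gauss_weight k J (matrix_inv J *v b)"
    using complete_square[OF J] by metis
  have g_gauss: "g = gauss_weight (C * k) J (matrix_inv J *v b)"
    using fun_cong[OF k(2)] by (intro ext) (simp add: g_eq gauss_weight_def mult.assoc)
  have Ck: "0 < C * k" using C k by simp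
  have xp: "xp = matrix_inv J *v b"
    using moments(2) mean_normalized_gauss[OF J Ck] unfolding g_gauss by simp
  have P: "P = matrix_inv J"
    using moments(3) second_moment_normalized_gauss[OF J Ck] unfolding xp g_gauss by simp
  have "J *v xp = b" unfolding xp by (rule matrix_inv_vec[OF pos_def_invertible[OF J]])
  then have "matrix_inv S *v m = J *v xp + transpose H *v (matrix_inv R *v y)"
    by (simp add: b_def D_def G_def)
  moreover have "matrix_inv S = J + transpose H ** matrix_inv R ** H"
    by (simp add: J_def D_def G_def)
  ultimately show "\<exists>J. pos_def J \<and> P = matrix_inv J \<and> matrix_inv S = J + transpose H ** matrix_inv R ** H \<and>
      matrix_inv S *v m = J *v xp + transpose H *v (matrix_inv R *v y)"
    using J P by blast
qed

text \<open>Selection as multiplication by a 0-1 matrix lets the transmitted noise inherit mean 0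
  and square integrability from the full noise by the lemmas on linear images.\<close>

lemma rr_select_matrix:
  "rr_select cq cp pad k z
    = (\<chi> j i. if i = cq (rr_slot CARD('q) CARD('p) pad k (cp j)) then 1 else 0) *v z"
  for z :: "real^'q" and cp :: "'p::finite \<Rightarrow> nat"
  by (simp add: rr_select_def matrix_vector_mult_def vec_eq_iff if_distrib[of "\<lambda>a. a * _"] cong: if_cong)

lemma integral_matrix_vector:
  fixes A :: "real^'n^'m"
  shows "integrable M X \<Longrightarrow> (\<integral>\<alpha>. A *v X \<alpha> \<partial>M) = A *v (\<integral>\<alpha>. X \<alpha> \<partial>M)"
  by (rule integral_bounded_linear[OF matrix_vector_mul_bounded_linear])

text \<open>Connects the initial estimate, defined as an expectation, with the centre of the initial
  information state. A density of a random vector has mass 1, so normalizing does not change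
  it.\<close>

lemma mean_of_density:
  fixes X :: "'a \<Rightarrow> real^'n"
  assumes M: "prob_space M" and X: "distributed M lborel X (\<lambda>z. ennreal (f z))"
    and f: "integrable lborel f" "\<And>z. 0 \<le> f z"
  shows "(\<integral>\<alpha>. X \<alpha> \<partial>M) = (\<integral>z. z \<partial>normalized f)"
proof -
  interpret M: prob_space M by (rule M)
  have X_meas: "X \<in> measurable M lborel" using X by (simp add: distributed_def)
  have law: "distr M lborel X = density lborel (\<lambda>z. ennreal (f z))" using X by (simp add: distributed_def)
  have "emeasure (distr M lborel X) UNIV = 1"
    using prob_space.emeasure_space_1[OF M.prob_space_distr[OF X_meas]] by simp
  then have "(\<integral>\<^sup>+z. ennreal (f z) \<partial>lborel) = 1"
    using f unfolding law by (subst (asm) emeasure_density) (auto dest: borel_measurable_integrable)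
  then have "(\<integral>z. f z \<partial>lborel) = 1"
    using f by (simp add: integral_eq_nn_integral borel_measurable_integrable)
  then have "normalized f = distr M lborel X" by (simp add: law normalized_def)
  then show ?thesis using integral_distr[OF X_meas, of "\<lambda>z. z"] by simp
qed

text \<open>\<open>matrix_inv\<close> is an unspecified matrix when there is no inverse, so the
  formulas have content only together with invertibility of \<open>Pyy k\<close>, which is therefore
  part of the conclusion.\<close>

theorem theorem4:
  fixes M :: "'a measure"
    and E A U V N A1 Abar :: "real^'n^'n" and B :: "real^'r^'n" and H Hbar :: "real^'n^'q"
    and S :: "'n set" and h :: nat and Bc :: "nat \<Rightarrow> real^'r^'n"
    and w :: "nat \<Rightarrow> 'a \<Rightarrow> real^'r" and v :: "nat \<Rightarrow> 'a \<Rightarrow> real^'q"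
    and x xbar Bw :: "nat \<Rightarrow> 'a \<Rightarrow> real^'n"
    and Q :: "nat \<Rightarrow> real^'r^'r" and Qbar :: "nat \<Rightarrow> real^'n^'n"
    and cq :: "nat \<Rightarrow> 'q" and cp :: "'p::finite \<Rightarrow> nat" and pad :: "nat \<Rightarrow> nat"
    and Hm :: "nat \<Rightarrow> real^'n^'p" and vm ym :: "nat \<Rightarrow> 'a \<Rightarrow> real^'p"
    and Rm :: "nat \<Rightarrow> real^'p^'p"
    and fy :: "nat \<Rightarrow> (nat \<Rightarrow> real^'p) \<Rightarrow> real"
    and \<omega> :: 'a and y :: "nat \<Rightarrow> real^'p"
    and \<mu>1 \<mu>2 :: "nat \<Rightarrow> real" and d :: nat
    and \<Phi> pred :: "nat \<Rightarrow> real^'n \<Rightarrow> real"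
    and xpost xpred :: "nat \<Rightarrow> real^'n" and Ppost Ppred :: "nat \<Rightarrow> real^'n^'n"
    and joint :: "nat \<Rightarrow> ((real^'n) \<times> (real^'p)) measure"
    and innov :: "nat \<Rightarrow> (real^'n) \<times> (real^'p) \<Rightarrow> real^'p"
    and Pyy :: "nat \<Rightarrow> real^'p^'p" and Pxy :: "nat \<Rightarrow> real^'p^'n"
  assumes M: "prob_space M"
    \<comment> \<open>the nominal stochastic singular system\<close>
    and singular: "rank E < CARD('n)"
    and regular: "\<exists>l. det (l *\<^sub>R E - A) \<noteq> 0"
    and system: "\<And>k \<alpha>. \<alpha> \<in> space M \<Longrightarrow> E *v x (Suc k) \<alpha> = A *v x k \<alpha> + B *v w k \<alpha>"
    \<comment> \<open>noises and initial state\<close>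
    and w_gauss: "\<And>k. gaussian_vector M (w k)" and w_mean: "\<And>k. (\<integral>\<alpha>. w k \<alpha> \<partial>M) = 0"
    and v_gauss: "\<And>k. gaussian_vector M (v k)" and v_mean: "\<And>k. (\<integral>\<alpha>. v k \<alpha> \<partial>M) = 0"
    and w_cov: "\<And>k. second_moment M (w k) (w k) = Q k"
    and w_white: "\<And>k j. k \<noteq> j \<Longrightarrow> second_moment M (w k) (w j) = 0"
    and wv_uncor: "\<And>k j. second_moment M (w k) (v j) = 0"
    and x_meas: "\<And>k. x k \<in> borel_measurable M"
    and x0_mean: "(\<integral>\<alpha>. x 0 \<alpha> \<partial>M) = 0"
    and x0_indep: "\<And>k. indep_vectors M (x 0) (v k)"
    \<comment> \<open>Weierstrass canonical form\<close>
    and UV: "invertible U" "invertible V"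
    and UEV: "U ** E ** V = block_diag S (mat 1) N"
    and UAV: "U ** A ** V = block_diag S A1 (mat 1)"
    and A1_block: "A1 = block_diag S A1 0" and N_block: "N = block_diag S 0 N"
    and N_nilpotent: "mat_pow N h = 0"
    and Abar: "Abar = block_diag S A1 0"
    and Bc: "\<And>i. Bc i = shift_coeff S N (U ** B) i"
    and Hbar: "Hbar = H ** V"
    and xbar: "\<And>k \<alpha>. xbar k \<alpha> = matrix_inv V *v x k \<alpha>"
    and Bw: "\<And>k \<alpha>. Bw k \<alpha> = (\<Sum>i\<le>h. Bc i *v w (k + i) \<alpha>)"
    and Qbar: "\<And>k. Qbar k = (\<Sum>i\<le>h. Bc i ** Q (k + i) ** transpose (Bc i))"
    \<comment> \<open>round-robin protocol\<close>
    and q'_le_q: "CARD('p) \<le> CARD('q)"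
    and cq: "bij_betw cq {1..CARD('q)} UNIV" and cp: "bij_betw cp UNIV {1..CARD('p)}"
    and pad: "\<And>j. (rr_period CARD('q) CARD('p) - 1) * CARD('p) + j > CARD('q) \<Longrightarrow> j \<le> CARD('p)
                \<Longrightarrow> pad j \<in> {1..(rr_period CARD('q) CARD('p) - 1) * CARD('p)}"
    and Hm: "\<And>k. Hm k = rr_select cq cp pad k Hbar"
    and vm: "\<And>k \<alpha>. vm k \<alpha> = rr_select cq cp pad k (v k \<alpha>)"
    and ym: "\<And>k \<alpha>. ym k \<alpha> = rr_select cq cp pad k (H *v x k \<alpha> + v k \<alpha>)"
    and Rm: "\<And>k. Rm k = second_moment M (vm k) (vm k)"
    \<comment> \<open>the round-robin induced periodic system\<close>
    and rrips_state: "\<And>k \<alpha>. \<alpha> \<in> space M \<Longrightarrow> xbar (Suc k) \<alpha> = Abar *v xbar k \<alpha> + Bw k \<alpha>"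
    and rrips_meas: "\<And>k \<alpha>. \<alpha> \<in> space M \<Longrightarrow> ym k \<alpha> = Hm k *v xbar k \<alpha> + vm k \<alpha>"
    \<comment> \<open>received measurements and their joint densities\<close>
    and \<omega>: "\<omega> \<in> space M" and y: "\<And>k. y k = ym k \<omega>"
    and fy: "\<And>k. distributed M (Pi\<^sub>M {1..k} (\<lambda>_. lborel)) (\<lambda>\<alpha>. \<lambda>i\<in>{1..k}. ym i \<alpha>)
                    (\<lambda>z. ennreal (fy k z))"
    and fy_pos: "\<And>k. 0 < fy k (restrict y {1..k})"
    \<comment> \<open>information state and predicted information state\<close>
    and \<mu>1_nonneg: "\<And>k. 0 \<le> \<mu>1 k" and \<mu>2_pos: "\<And>k. 0 < \<mu>2 k"
    \<comment> \<open>d = 1: the step from k - 1 to k is driven by the noise of index k - 1, as in the state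
      equation, so the predicted covariance has Qbar (k - 1); d = 0: both have index k\<close>
    and d: "d \<le> 1"
    and \<Phi>_0: "distributed M lborel (xbar 0) (\<lambda>z. ennreal (\<Phi> 0 z))"
    and pred: "\<And>k. 1 \<le> k \<Longrightarrow>
          predicts (\<lambda>x'. distr M borel (\<lambda>\<alpha>. Abar *v x' + Bw (k - d) \<alpha>))
            (\<lambda>x'. exp (\<mu>1 (k - 1) * ((x' - xpost (k - 1)) \<bullet> (x' - xpost (k - 1)))) * \<Phi> (k - 1) x')
            (pred k)"
    and \<Phi>_step: "\<And>k z. 1 \<le> k \<Longrightarrow>
          \<Phi> k z = mvn_density (Hm k *v z) (Rm k) (y k) * pred k z / cond_density fy y k"
    \<comment> \<open>standing assumptions on the filter\<close>
    and \<Phi>_gauss: "\<And>k. unnormalized_gaussian (\<Phi> k)"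
    and \<mu>1_small: "\<And>k. pos_def (mat 1 - (2 * \<mu>1 k) *\<^sub>R Ppost k)"
    \<comment> \<open>posterior estimate and posterior error covariance\<close>
    and xpost_0: "xpost 0 = (\<integral>\<alpha>. xbar 0 \<alpha> \<partial>M)"
    and xpost: "\<And>k. 1 \<le> k \<Longrightarrow> is_minimizer (risk_cost (\<mu>2 k) (\<Phi> k)) (xpost k)"
    and Ppost: "\<And>k. Ppost k = covariance (normalized (\<Phi> k)) (\<lambda>z. z)"
    \<comment> \<open>predicted quantities\<close>
    and xpred: "\<And>k. 1 \<le> k \<Longrightarrow> xpred k = Abar *v xpost (k - 1)"
    and Ppred: "\<And>k. 1 \<le> k \<Longrightarrow>
          Ppred k = Abar ** matrix_inv (matrix_inv (Ppost (k - 1)) - mat (2 * \<mu>1 (k - 1))) ** transpose Abar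
                    + Qbar (k - d)"
    \<comment> \<open>innovation and cross covariances, given the information up to time k - 1\<close>
    and joint: "\<And>k. joint k = normalized (pred k) \<Otimes>\<^sub>M distr M borel (vm k)"
    and innov: "\<And>k z n. innov k (z, n) = (Hm k *v z + n) - Hm k *v xpred k"
    and Pyy: "\<And>k. Pyy k = second_moment (joint k) (innov k) (innov k)"
    and Pxy: "\<And>k. Pxy k = second_moment (joint k) (\<lambda>s. fst s - xpred k) (innov k)"
  shows "\<forall>k\<ge>1.
      xpost k = xpred k + Pxy k *v (matrix_inv (Pyy k) *v (y k - Hm k *v xpred k)) \<and>
      Ppost k = Ppred k - Pxy k ** matrix_inv (Pyy k) ** transpose (Pxy k) \<and>
      Pyy k = Hm k ** Ppred k ** transpose (Hm k) + Rm k \<and> invertible (Pyy k) \<and>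
      Pxy k = Ppred k ** transpose (Hm k)"
proof (intro allI impI)
  fix k :: nat assume k: "1 \<le> k"
  interpret M: prob_space M by (rule M)
  note w_si = gaussian_vector_square_integrable[OF w_gauss]
  note v_si = gaussian_vector_square_integrable[OF v_gauss]

  have vm_eq: "vm k = (\<lambda>\<alpha>. (\<chi> j i. if i = cq (rr_slot CARD('q) CARD('p) pad k (cp j)) then 1 else 0) *v v k \<alpha>)"
    by (rule ext) (simp only: vm rr_select_matrix)
  have vm_si: "square_integrable M (vm k)"
    unfolding vm_eq by (rule square_integrable_matrix_vector[OF v_si])
  have vm_mean: "(\<integral>\<alpha>. vm k \<alpha> \<partial>M) = 0"
    unfolding vm_eq integral_matrix_vector[OF M.square_integrable_integrable[OF v_si]] v_mean by simp

  \<comment> \<open>Index of the noise that drives the step into time \<open>k\<close>; the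
    prediction kernel and the summand \<open>Qbar\<close> refer to the same index for either value
    of \<open>d\<close>.\<close>
  define j where "j = k - d"
  have Bw_eq: "Bw j = (\<lambda>\<alpha>. \<Sum>i\<in>{..h}. Bc i *v w (j + i) \<alpha>)" by (rule ext) (rule Bw)
  have Bw_term: "square_integrable M (\<lambda>\<alpha>. Bc i *v w (j + i) \<alpha>)" for i
    by (rule square_integrable_matrix_vector[OF w_si])
  have Bw_si: "square_integrable M (Bw j)"
    unfolding Bw_eq by (rule square_integrable_sum[OF Bw_term])
  have Bw_mean: "(\<integral>\<alpha>. Bw j \<alpha> \<partial>M) = 0"
    unfolding Bw_eq
    by (simp add: Bochner_Integration.integral_sum M.square_integrable_integrable[OF Bw_term]
        integral_matrix_vector M.square_integrable_integrable[OF w_si] w_mean)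
  have Bw_cov: "second_moment M (Bw j) (Bw j) = Qbar j"
    unfolding Bw_eq Qbar w_cov[symmetric]
    by (rule second_moment_linear_combination[OF finite_atMost w_si]) (simp add: w_white)

  \<comment> \<open>Holds at each index separately. At index 0 there is no cost to minimize, and the
    estimate is the expectation of the initial state.\<close>
  have \<Phi>_shape: "\<exists>a S m. 0 < a \<and> pos_def S \<and> \<Phi> i = gauss_weight a (matrix_inv S) m \<and> xpost i = m \<and> Ppost i = S"
    for i
  proof -
    obtain a S m where s: "0 < a" "pos_def S" "\<Phi> i = gauss_weight a (matrix_inv S) m"
      using unnormalized_gaussian_gauss_weight[OF \<Phi>_gauss[of i]] by metis
    note J = pos_def_matrix_inv[OF s(2)]
    have "Ppost i = S"
      unfolding Ppost s(3) covariance_normalized_gauss[OF J s(1)]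
      by (rule matrix_inv_inv[OF pos_def_invertible[OF s(2)]])
    moreover have "xpost i = m"
    proof (cases "i = 0")
      case True
      have "(\<integral>\<alpha>. xbar 0 \<alpha> \<partial>M) = (\<integral>z. z \<partial>normalized (\<Phi> 0))"
        using s by (intro mean_of_density[OF M \<Phi>_0])
          (simp_all add: True gauss_weight_integrable[OF J] gauss_weight_pos less_imp_le)
      then show ?thesis
        using s True by (simp add: xpost_0 mean_normalized_gauss[OF J])
    next
      case False
      then have "is_minimizer (risk_cost (\<mu>2 i) (\<Phi> i)) (xpost i)" by (intro xpost) simp
      then show ?thesis using risk_cost_minimizer[OF s(1) \<mu>2_pos[of i]] by (simp add: s(3))
    qed
    ultimately show ?thesis using s by blast
  qed

  obtain a' S' m' where prev: "0 < a'" "pos_def S'" "\<Phi> (k - 1) = gauss_weight a' (matrix_inv S') m'"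
      "xpost (k - 1) = m'" "Ppost (k - 1) = S'"
    using \<Phi>_shape by metis
  let ?\<mu> = "\<mu>1 (k - 1)"
  let ?J' = "matrix_inv S' - mat (2 * ?\<mu>)"
  have J': "pos_def ?J'"
    using \<mu>1_small[of "k - 1"] by (intro pos_def_tilt prev \<mu>1_nonneg) (simp only: prev)
  let ?f = "gauss_weight a' ?J' m'"
  note f_props = gauss_weight_integrable[OF J'] less_imp_le[OF gauss_weight_pos[OF prev(1)]]
    gauss_weight_integral_pos[OF J' prev(1)]
  \<comment> \<open>Since \<open>xpost (k - 1)\<close> is the centre \<open>m'\<close>, the
    exponential of the last error is a tilt about the mean, and the weight entering the prediction
    is again Gaussian.\<close>
  have pred_k: "predicts (\<lambda>x'. distr M borel (\<lambda>\<alpha>. Abar *v x' + Bw j \<alpha>)) ?f (pred k)"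
    using pred[OF k] by (simp only: prev gauss_weight_tilt j_def)
  note np = normalized_predicts[OF M square_integrable_measurable[OF Bw_si] f_props pred_k]
  have pred_nonneg: "0 \<le> pred k z" for z using pred_k by (simp add: predicts_def)
  have xpred_k: "xpred k = Abar *v m'" using xpred[OF k] prev by simp
  note pm = predicted_moments[OF M prob_space_normalized_gauss[OF J' prev(1)] sets_normalized
      square_integrable_normalized_gauss[OF J' prev(1)] mean_normalized_gauss[OF J' prev(1)]
      Bw_si Bw_mean np(3), folded xpred_k]
  have pm3: "second_moment (normalized (pred k)) (\<lambda>z. z - xpred k) (\<lambda>z. z - xpred k) = Ppred k"
    unfolding pm(3) second_moment_normalized_gauss[OF J' prev(1)] Bw_cov Ppred[OF k]
    by (simp only: prev j_def)

  have joint_moments: "Pyy k = Hm k ** Ppred k ** transpose (Hm k) + Rm k"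
      "Pxy k = Ppred k ** transpose (Hm k)"
    unfolding Pyy Pxy Rm
    using innovation_moments[OF prob_space_normalized[OF np(1) pred_nonneg np(2)] M pm(1) vm_si vm_mean pm3
        joint[of k] innov[of k]]
    by blast+

  obtain a S m where post: "0 < a" "pos_def S" "\<Phi> k = gauss_weight a (matrix_inv S) m"
      "xpost k = m" "Ppost k = S"
    using \<Phi>_shape by metis
  have bayes: "gauss_weight a (matrix_inv S) m z = mvn_density (Hm k *v z) (Rm k) (y k) * pred k z / cond_density fy y k"
    for z using \<Phi>_step[OF k, of z] by (simp add: post)
  have Rm_pd: "invertible (Rm k) \<Longrightarrow> pos_def (Rm k)"
    unfolding Rm by (rule second_moment_invertible_imp_pos_def[OF vm_si])
  note info = posterior_information[OF post(2,1) bayes Rm_pd np(1) pred_nonneg np(2) pm(1,2) pm3]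
  obtain J where J: "pos_def J" "Ppred k = matrix_inv J"
      "matrix_inv S = J + transpose (Hm k) ** matrix_inv (Rm k) ** Hm k"
      "matrix_inv S *v m = J *v xpred k + transpose (Hm k) *v (matrix_inv (Rm k) *v y k)"
    using info(2) by blast
  have "transpose (Ppred k) = Ppred k" unfolding J(2) by (rule pos_def_symmetric[OF pos_def_matrix_inv[OF J(1)]])
  then have Pxy_t: "transpose (Pxy k) = Hm k ** Ppred k"
    by (simp add: joint_moments matrix_transpose_mul)
  \<comment> \<open>Definiteness of both summands is available only now: for \<open>Ppred k\<close>
    through \<open>J\<close>, for \<open>Rm k\<close> through \<open>info(1)\<close>.\<close>
  have "invertible (Pyy k)"
    unfolding joint_moments(1) J(2)
    by (rule pos_def_invertible[OF pos_def_congruence_add[OF pos_def_matrix_inv[OF J(1)] info(1)]])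
  moreover have "m = xpred k + Pxy k *v (matrix_inv (Pyy k) *v (y k - Hm k *v xpred k))"
    unfolding joint_moments(2)
    by (rule kalman_mean[OF J(1) info(1) post(2) J(3) J(2) joint_moments(1) J(4)])
  moreover have "S = Ppred k - Pxy k ** matrix_inv (Pyy k) ** transpose (Pxy k)"
    unfolding Pxy_t unfolding joint_moments(2)
    by (rule kalman_covariance[OF J(1) info(1) post(2) J(3) J(2) joint_moments(1)])
  ultimately show "xpost k = xpred k + Pxy k *v (matrix_inv (Pyy k) *v (y k - Hm k *v xpred k)) \<and>
      Ppost k = Ppred k - Pxy k ** matrix_inv (Pyy k) ** transpose (Pxy k) \<and>
      Pyy k = Hm k ** Ppred k ** transpose (Hm k) + Rm k \<and> invertible (Pyy k) \<and>
      Pxy k = Ppred k ** transpose (Hm k)"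
    unfolding post using joint_moments by (intro conjI)
qed

end
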